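(* Fix $d\ge1$, $s\in(0,1]$, $L_H>0$ and $M_w>0$. Suppose that $w:\overline\Omega_L\to[0,\infty)$ is bounded and Lipschitz, vanishes on $\Delta_L$, and satisfies $w(u)>0$ for every $u\in\Omega_L$. Let $\mathcal P_{\mathrm{bm}}(s,L_H,M_w)$ be the class of joint laws $P$ of $(Z,D)$ such that: (1) $Z$ is uniformly distributed on $\mathcal Z=[0,1]^d$; (2) $D$ is a persistence diagram supported in $\Omega_L$ and $\mu_D^w(\overline\Omega_L)\le M_w$ almost surely; (3) the conditional weighted mean measure $\Lambda_z^w(A)=\mathbb E_P[\mu_D^w(A)\mid Z=z]$ admits a density $\lambda_{w,P}(z,u)$ with respect to Lebesgue measure on $\overline\Omega_L$ belonging to $\Sigma(s,L_H)$. Then there exist constants $c,c_0>0$, depending only on $d,s,L_H,M_w,w$ and $L$, such that, for all sufficiently large $n$, $$\inf_{\widehat\lambda}\ \sup_{P\in\mathcal P_{\mathrm{bm}}(s,L_H,M_w)}P^{\otimes n}\left(\|\widehat\lambda-\lambda_{w,P}\|_\infty\ge c\left(\frac{\log n}{n}\right)^{s/(2s+d+2)}\right)\ge c_0,$$ where the infimum is over all measurable estimators based on $(Z_1,D_1),\dots,(Z_n,D_n)$.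
   Context: Fix $L>0$ and let $\Omega_L=\{(b,t):0\le b<t\le L\}$, $\overline\Omega_L=\{(b,t):0\le b\le t\le L\}$, $\Delta_L=\{(b,b):0\le b\le L\}$. $\|\cdot\|$ is the Euclidean norm. A persistence diagram $D$ supported in $\Omega_L$ is identified with a locally finite counting measure $\mu_D=\sum_{x\in D}a_x\delta_x$, $a_x\in\mathbb N$ (the empty diagram is allowed), and $\mu_D^w(A)=\int_Aw\,d\mu_D$ for Borel $A\subseteq\overline\Omega_L$. For bounded $g:\mathcal Z\times\overline\Omega_L\to\mathbb R$, $\|g\|_\infty=\sup_{z\in\mathcal Z,u\in\overline\Omega_L}|g(z,u)|$. $\Sigma(s,L_H)$ is the class of functions $g:\mathcal Z\times\overline\Omega_L\to\mathbb R$ with $|g(z,u)-g(z',u')|\le L_H(\|z-z'\|+\|u-u'\|)^s$ for all $z,z'\in\mathcal Z$, $u,u'\in\overline\Omega_L$. $P^{\otimes n}$ is the law of $n$ i.i.d. pairs $(Z_i,D_i)\sim P$. *)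

theory Defs
  imports "HOL-Probability.Probability"
begin

definition open_triangle :: "real \<Rightarrow> (real \<times> real) set" where
  "open_triangle L = {(b, t). 0 \<le> b \<and> b < t \<and> t \<le> L}"

definition closed_triangle :: "real \<Rightarrow> (real \<times> real) set" where
  "closed_triangle L = {(b, t). 0 \<le> b \<and> b \<le> t \<and> t \<le> L}"

definition diagonal :: "real \<Rightarrow> (real \<times> real) set" where
  "diagonal L = {(b, b) | b. 0 \<le> b \<and> b \<le> L}"

definition unit_cube :: "(real ^ 'd) set" where
  "unit_cube = {z. \<forall>i. 0 \<le> z $ i \<and> z $ i \<le> 1}"

text \<open>
  A diagram is encoded by its multiplicity function: \<open>D x\<close> is the number of copies of the
  point \<open>x\<close>. The associated Borel counting measure is the sum of the \<open>D x\<close>-multiples of the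
  Dirac measures at \<open>x\<close>.
\<close>

type_synonym diagram = "real \<times> real \<Rightarrow> nat"

definition diagram_measure :: "diagram \<Rightarrow> (real \<times> real) measure" where
  "diagram_measure D = distr (density (count_space UNIV) (\<lambda>x. of_nat (D x))) borel (\<lambda>x. x)"

text \<open>
  Local finiteness is relative to the off-diagonal triangle, whose compact subsets stay away from
  the diagonal; points may accumulate at the diagonal. The constant \<open>0\<close> is the empty diagram.
\<close>

definition diagrams :: "real \<Rightarrow> diagram set" where
  "diagrams L = {D. (\<forall>x. D x \<noteq> 0 \<longrightarrow> x \<in> open_triangle L) \<and>
     (\<forall>K. compact K \<and> K \<subseteq> open_triangle L \<longrightarrow> emeasure (diagram_measure D) K < \<infinity>)}"

text \<open>
  The usual \<open>\<sigma>\<close>-algebra for point processes: the smallest one making the evaluation of the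
  counting measure at every Borel set measurable. (The null measure carried by
  \<open>diagram_space\<close> is irrelevant.)
\<close>

definition diagram_space :: "real \<Rightarrow> diagram measure" where
  "diagram_space L = sigma (diagrams L)
     {(\<lambda>D. emeasure (diagram_measure D) A) -` B \<inter> diagrams L | A B.
        A \<in> sets borel \<and> B \<in> sets borel}"

definition weighted_mass ::
  "(real \<times> real \<Rightarrow> real) \<Rightarrow> diagram \<Rightarrow> (real \<times> real) set \<Rightarrow> ennreal" where
  "weighted_mass w D A = (\<integral>\<^sup>+ u \<in> A. ennreal (w u) \<partial>diagram_measure D)"

definition observation_space :: "real \<Rightarrow> ((real ^ 'd) \<times> diagram) measure" where
  "observation_space L = borel \<Otimes>\<^sub>M diagram_space L"

definition holder_class ::
  "real \<Rightarrow> real \<Rightarrow> real \<Rightarrow> (real ^ 'd \<Rightarrow> real \<times> real \<Rightarrow> real) set" where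
  "holder_class L s LH = {g. \<forall>z \<in> unit_cube. \<forall>z' \<in> unit_cube.
     \<forall>u \<in> closed_triangle L. \<forall>u' \<in> closed_triangle L.
       \<bar>g z u - g z' u'\<bar> \<le> LH * (norm (z - z') + norm (u - u')) powr s}"

text \<open>
  \<open>g\<close> is a density, lying in the Hoelder class, of the conditional weighted mean measure
  given \<open>Z\<close>: for every Borel \<open>A\<close>, the conditional expectation of \<open>\<mu>_D^w(A)\<close> given the
  \<open>\<sigma>\<close>-algebra generated by \<open>Z = fst\<close> is almost surely the integral of \<open>g Z\<close> over \<open>A\<close>.
  Nonnegativity is stated because \<open>ennreal\<close> would silently cut off negative values.
\<close>

definition is_holder_mean_density ::
  "real \<Rightarrow> (real \<times> real \<Rightarrow> real) \<Rightarrow> real \<Rightarrow> real \<Rightarrow> ((real ^ 'd) \<times> diagram) measure \<Rightarrow>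
     (real ^ 'd \<Rightarrow> real \<times> real \<Rightarrow> real) \<Rightarrow> bool" where
  "is_holder_mean_density L w s LH P g \<longleftrightarrow>
     g \<in> holder_class L s LH \<and>
     (\<forall>z \<in> unit_cube. \<forall>u \<in> closed_triangle L. 0 \<le> g z u) \<and>
     (\<forall>A \<in> sets borel. A \<subseteq> closed_triangle L \<longrightarrow>
       (AE \<omega> in P.
          nn_cond_exp P (vimage_algebra (space P) fst borel)
            (\<lambda>\<omega>'. weighted_mass w (snd \<omega>') A) \<omega>
          = (\<integral>\<^sup>+ u \<in> A. ennreal (g (fst \<omega>) u) \<partial>lborel)))"

definition model_class ::
  "real \<Rightarrow> (real \<times> real \<Rightarrow> real) \<Rightarrow> real \<Rightarrow> real \<Rightarrow> real \<Rightarrow>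
     ((real ^ 'd) \<times> diagram) measure set" where
  "model_class L w s LH Mw = {P.
     prob_space P \<and> sets P = sets (observation_space L) \<and>
     distr P borel fst = uniform_measure lborel unit_cube \<and>
     (AE \<omega> in P. weighted_mass w (snd \<omega>) (closed_triangle L) \<le> ennreal Mw) \<and>
     (\<exists>g. is_holder_mean_density L w s LH P g)}"

text \<open>
  For \<open>s > 0\<close>, \<open>L > 0\<close> and uniform \<open>Z\<close>, any two such densities are continuous and agree almost
  everywhere, hence everywhere, on the product of the cube and the closed triangle. The choice
  therefore only affects values outside this product, which \<open>sup_dist\<close> below ignores.
\<close>

definition mean_density ::
  "real \<Rightarrow> (real \<times> real \<Rightarrow> real) \<Rightarrow> real \<Rightarrow> real \<Rightarrow> ((real ^ 'd) \<times> diagram) measure \<Rightarrow>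
     real ^ 'd \<Rightarrow> real \<times> real \<Rightarrow> real" where
  "mean_density L w s LH P = (SOME g. is_holder_mean_density L w s LH P g)"

text \<open>The sup norm of \<open>f - g\<close>, with value \<open>\<infinity>\<close> if the difference is unbounded.\<close>

definition sup_dist ::
  "real \<Rightarrow> (real ^ 'd \<Rightarrow> real \<times> real \<Rightarrow> real) \<Rightarrow> (real ^ 'd \<Rightarrow> real \<times> real \<Rightarrow> real) \<Rightarrow> ennreal"
  where
  "sup_dist L f g = (SUP z \<in> unit_cube. SUP u \<in> closed_triangle L. ennreal \<bar>f z u - g z u\<bar>)"

definition sample_law :: "nat \<Rightarrow> 'a measure \<Rightarrow> (nat \<Rightarrow> 'a) measure" where
  "sample_law n P = (\<Pi>\<^sub>M i \<in> {1..n}. P)"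

text \<open>
  An estimator maps a sample to a function on the product of the cube and the closed triangle; it
  is measurable if each of its point evaluations is a measurable function of the sample. Jointly
  measurable estimators, and those measurable as random elements of the space of bounded functions
  with the sup norm, are included.
\<close>

definition estimators ::
  "real \<Rightarrow> nat \<Rightarrow> ((nat \<Rightarrow> (real ^ 'd) \<times> diagram) \<Rightarrow> real ^ 'd \<Rightarrow> real \<times> real \<Rightarrow> real) set" where
  "estimators L n = {T. \<forall>z \<in> unit_cube. \<forall>u \<in> closed_triangle L.
     (\<lambda>x. T x z u) \<in> borel_measurable (\<Pi>\<^sub>M i \<in> {1..n}. observation_space L)}"

text \<open>
  For such general estimators the loss is a supremum of uncountably many measurable functions, so
  the event that it exceeds a threshold may fail to be measurable. Its probability is the outer
  probability, which is the ordinary one whenever the event is measurable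
  (see \<open>outer_measure_of_eq\<close>).
\<close>

definition exceedance_prob ::
  "real \<Rightarrow> (real \<times> real \<Rightarrow> real) \<Rightarrow> real \<Rightarrow> real \<Rightarrow> nat \<Rightarrow> real \<Rightarrow>
     ((nat \<Rightarrow> (real ^ 'd) \<times> diagram) \<Rightarrow> real ^ 'd \<Rightarrow> real \<times> real \<Rightarrow> real) \<Rightarrow>
     ((real ^ 'd) \<times> diagram) measure \<Rightarrow> ennreal" where
  "exceedance_prob L w s LH n r T P =
     outer_measure_of (sample_law n P)
       {x \<in> space (sample_law n P). ennreal r \<le> sup_dist L (T x) (mean_density L w s LH P)}"

end

theory Submission
  imports Defs "HOL-Real_Asymp.Real_Asymp"
begin

text \<open>
  The lower bound is a many-hypotheses testing argument. If an estimator has small uniform error, it can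
  tell a fixed density from any of \<open>M\<close> perturbations of it by a local bump of height about \<open>h powr s\<close>, the
  largest that an \<open>s\<close>-Hoelder function of scale \<open>h\<close> allows. But a bump of scale \<open>h\<close> lives in \<open>d\<close>
  covariate dimensions and \<open>2\<close> diagram dimensions, so it moves the law of one observation by a
  chi-square distance \<open>\<rho>\<close> of order \<open>h powr (2 * s + d + 2)\<close> only. If
  \<open>h = (\<kappa> * ln n / n) powr (1 / (2 * s + d + 2))\<close> with \<open>\<kappa>\<close> small, then for \<open>n\<close> observations the likelihood
  ratio of each single bump has second moment at most \<open>(1 + \<rho>) ^ n\<close>, a small power of \<open>n\<close>. Since there are
  polynomially many bumps with disjoint supports, the uniform mixture of the perturbed laws is
  asymptotically indistinguishable from the unperturbed law (\<open>mixture_second_moment\<close>), and no test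
  can work (\<open>many_hypotheses_testing\<close>).

  The laws are realised by diagrams with at most one point. Choose a ball \<open>K\<close> off the diagonal but so close
  to it that \<open>w \<le> Mw\<close> there (\<open>near_diagonal_ball\<close>). Draw the covariate \<open>Z\<close> uniformly on the cube and
  \<open>U\<close> uniformly on \<open>K\<close>; given \<open>Z\<close> and \<open>U\<close>, let the diagram consist of the point \<open>U\<close> with
  probability \<open>|K| * g Z U / w U\<close>, and let it be empty otherwise. The weighted mean density of this law is
  \<open>g\<close>, and the law belongs to the model if \<open>g\<close> is a small enough Hoelder function supported in \<open>K\<close>
  (\<open>thinned_law_in_model_class\<close>). The empty diagram absorbs every change of mass, so the bumps need not
  integrate to zero. The likelihood ratios are explicit (\<open>marked_points_hypothesis\<close>) and yield \<open>\<rho>\<close>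
  (\<open>excess_second_moment\<close>).

  A density in the model class is determined by the law at interior points (\<open>mean_density_eq\<close>), so that
  at the centres of the bumps the estimand has the value built into the construction. Evaluating the estimator
  at these finitely many points yields a measurable test although the uniform loss may not be measurable
  (\<open>exceedance_prob_ge\<close>).
\<close>

section \<open>Testing one law against many disjoint perturbations\<close>

lemma PiM_density:
  fixes l :: "'a \<Rightarrow> ennreal"
  assumes "prob_space M" and "finite I" and [measurable]: "l \<in> borel_measurable M"
    and "prob_space (density M l)"
  shows "(\<Pi>\<^sub>M i\<in>I. density M l) = density (\<Pi>\<^sub>M i\<in>I. M) (\<lambda>x. \<Prod>i\<in>I. l (x i))"
proof -
  interpret D: product_prob_space "\<lambda>i. density M l" I
    by (rule product_prob_spaceI) fact
  interpret M: product_prob_space "\<lambda>i. M" I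
    by (rule product_prob_spaceI) fact
  show ?thesis
  proof (rule D.PiM_eqI[symmetric])
    show "finite I" by fact
    show "sets (density (\<Pi>\<^sub>M i\<in>I. M) (\<lambda>x. \<Prod>i\<in>I. l (x i))) = sets (\<Pi>\<^sub>M i\<in>I. density M l)"
      by (simp cong: sets_PiM_cong)
    fix A assume A: "\<And>i. i \<in> I \<Longrightarrow> A i \<in> sets (density M l)"
    have [measurable]: "i \<in> I \<Longrightarrow> A i \<in> sets M" for i using A by simp
    have PiE: "Pi\<^sub>E I A \<in> sets (\<Pi>\<^sub>M i\<in>I. M)"
      using \<open>finite I\<close> by (intro sets_PiM_I_finite) auto
    have "emeasure (density (\<Pi>\<^sub>M i\<in>I. M) (\<lambda>x. \<Prod>i\<in>I. l (x i))) (Pi\<^sub>E I A)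
        = (\<integral>\<^sup>+x. (\<Prod>i\<in>I. l (x i)) * indicator (Pi\<^sub>E I A) x \<partial>(\<Pi>\<^sub>M i\<in>I. M))"
      by (rule emeasure_density[OF _ PiE]) measurable
    also have "\<dots> = (\<integral>\<^sup>+x. (\<Prod>i\<in>I. l (x i) * indicator (A i) (x i)) \<partial>(\<Pi>\<^sub>M i\<in>I. M))"
    proof (rule nn_integral_cong)
      fix x assume x: "x \<in> space (\<Pi>\<^sub>M i\<in>I. M)"
      have "(indicator (Pi\<^sub>E I A) x :: ennreal) = (\<Prod>i\<in>I. indicator (A i) (x i))"
      proof (cases "\<forall>i\<in>I. x i \<in> A i")
        case True
        then show ?thesis using x by (auto simp: space_PiM PiE_iff)
      next
        case False
        then obtain i where "i \<in> I" "x i \<notin> A i" by auto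
        then have "(\<Prod>i\<in>I. indicator (A i) (x i) :: ennreal) = 0"
          using \<open>finite I\<close> by (intro prod_zero) (auto intro!: bexI[of _ i])
        moreover have "x \<notin> Pi\<^sub>E I A" using \<open>i \<in> I\<close> \<open>x i \<notin> A i\<close> by (auto simp: PiE_iff)
        ultimately show ?thesis by simp
      qed
      then show "(\<Prod>i\<in>I. l (x i)) * indicator (Pi\<^sub>E I A) x
          = (\<Prod>i\<in>I. l (x i) * indicator (A i) (x i))"
        by (simp add: prod.distrib)
    qed
    also have "\<dots> = (\<Prod>i\<in>I. \<integral>\<^sup>+x. l x * indicator (A i) x \<partial>M)"
      using \<open>finite I\<close> by (intro M.product_nn_integral_prod) auto
    also have "\<dots> = (\<Prod>i\<in>I. emeasure (density M l) (A i))"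
      by (intro prod.cong refl) (simp add: emeasure_density)
    finally show "emeasure (density (\<Pi>\<^sub>M i\<in>I. M) (\<lambda>x. \<Prod>i\<in>I. l (x i))) (Pi\<^sub>E I A)
        = (\<Prod>i\<in>I. emeasure (density M l) (A i))" .
  qed
qed

text \<open>
  If the perturbations have pairwise disjoint supports, the cross terms of the second moment of the
  averaged likelihood ratio \<open>q\<close> are exactly \<open>1\<close>: \<open>\<integral>(1 + \<delta>\<^sub>j)(1 + \<delta>\<^sub>k) = 1\<close>, because the \<open>\<delta>\<close>s are centred and
  \<open>\<delta>\<^sub>j \<delta>\<^sub>k = 0\<close>. Only the \<open>M\<close> diagonal terms, out of \<open>M\<^sup>2\<close>, can be large, so the averaging
  gains a factor \<open>M\<close> over a single alternative. With \<open>M\<close> a power of the sample size this is what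
  produces the logarithm in the rate.
\<close>

lemma mixture_second_moment:
  fixes \<delta> :: "nat \<Rightarrow> 'a \<Rightarrow> real"
  assumes N: "prob_space N" and I: "finite I" and M: "0 < M"
    and \<delta>_meas: "\<And>j. j < M \<Longrightarrow> \<delta> j \<in> borel_measurable N"
    and \<delta>_bound: "\<And>j x. j < M \<Longrightarrow> \<bar>\<delta> j x\<bar> \<le> 1"
    and mean: "\<And>j. j < M \<Longrightarrow> (\<integral>x. \<delta> j x \<partial>N) = 0"
    and var: "\<And>j. j < M \<Longrightarrow> (\<integral>x. (\<delta> j x)\<^sup>2 \<partial>N) \<le> \<rho>"
    and disj: "\<And>j k x. \<lbrakk>j < M; k < M; j \<noteq> k\<rbrakk> \<Longrightarrow> \<delta> j x * \<delta> k x = 0"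
    and small: "4 * (1 + \<rho>) ^ card I \<le> real M"
  defines "q \<equiv> \<lambda>x. (\<Sum>j<M. \<Prod>i\<in>I. 1 + \<delta> j (x i)) / real M"
  shows "q \<in> borel_measurable (\<Pi>\<^sub>M i\<in>I. N)"
    and "\<And>x. 0 \<le> q x" and "\<And>x. q x \<le> 2 ^ card I"
    and "(\<integral>x. (q x - 1)\<^sup>2 \<partial>(\<Pi>\<^sub>M i\<in>I. N)) \<le> 1/4"
proof -
  interpret N: prob_space N by fact
  interpret P: product_prob_space "\<lambda>i. N" "I"
    by (rule product_prob_spaceI) fact
  let ?P = "\<Pi>\<^sub>M i\<in>I. N"
  have P1: "measure ?P (space ?P) = 1"
    by (intro prob_space.prob_space prob_space_PiM N)
  let ?l = "\<lambda>j x. \<Prod>i\<in>I. 1 + \<delta> j (x i)"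
  have l_meas: "?l j \<in> borel_measurable ?P" if "j < M" for j
    using \<delta>_meas[OF that] by measurable
  have l_bd: "0 \<le> ?l j x \<and> ?l j x \<le> 2 ^ card I" if "j < M" for j x
  proof -
    have *: "0 \<le> 1 + \<delta> j (x i) \<and> 1 + \<delta> j (x i) \<le> 2" for i using \<delta>_bound[OF that, of "x i"] by auto
    have "?l j x \<le> (\<Prod>i\<in>I. 2)" by (rule prod_mono) (use * in auto)
    moreover have "0 \<le> ?l j x" by (rule prod_nonneg) (use * in auto)
    ultimately show ?thesis by simp
  qed
  show q_meas: "q \<in> borel_measurable ?P"
    unfolding q_def using l_meas by measurable
  show q0: "0 \<le> q x" for x unfolding q_def using l_bd by (auto intro!: divide_nonneg_nonneg sum_nonneg)
  have "(\<Sum>j<M. ?l j x) \<le> (\<Sum>j<M. 2 ^ card I)" for x by (rule sum_mono) (use l_bd in auto)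
  then show q2: "q x \<le> 2 ^ card I" for x unfolding q_def using M by (simp add: field_simps)
  have int_N: "integrable N (\<lambda>x. \<delta> j x)" "integrable N (\<lambda>x. (\<delta> j x)\<^sup>2)"
    "integrable N (\<lambda>x. \<delta> j x * \<delta> k x)" if "j < M" "k < M" for j k
  proof -
    note [measurable] = \<delta>_meas[OF that(1)] \<delta>_meas[OF that(2)]
    have b: "\<bar>\<delta> j x * \<delta> k x\<bar> \<le> 1" "\<bar>(\<delta> j x)\<^sup>2\<bar> \<le> 1" for x
      using \<delta>_bound[OF that(1)] \<delta>_bound[OF that(2)]
      by (auto simp: abs_mult intro!: mult_le_one) (metis abs_square_le_1)
    show "integrable N (\<lambda>x. \<delta> j x)" "integrable N (\<lambda>x. (\<delta> j x)\<^sup>2)"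
      "integrable N (\<lambda>x. \<delta> j x * \<delta> k x)"
      using b \<delta>_bound[OF that(1)] by (auto intro!: N.integrable_const_bound[of _ 1])
  qed
  have int_l: "integrable ?P (?l j)" "integrable ?P (\<lambda>x. ?l j x * ?l k x)"
    if jk: "j < M" "k < M" for j k
  proof -
    show "integrable ?P (?l j)"
      using l_bd l_meas jk by (intro P.integrable_const_bound[of _ "2^card I"]) auto
    have "\<bar>?l j x * ?l k x\<bar> \<le> 2^card I * 2^card I" for x
      unfolding abs_mult by (rule mult_mono) (use l_bd jk in auto)
    then show "integrable ?P (\<lambda>x. ?l j x * ?l k x)"
      using l_meas jk by (intro P.integrable_const_bound[of _ "2^card I * 2^card I"]) auto
  qed
  have El: "(\<integral>x. ?l j x \<partial>?P) = 1" if j: "j < M" for j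
  proof -
    have "(\<integral>x. ?l j x \<partial>?P) = (\<Prod>i\<in>I. \<integral>x. 1 + \<delta> j x \<partial>N)"
      by (rule P.product_integral_prod[OF I]) (use int_N j in auto)
    also have "\<dots> = 1" using int_N[OF j j] mean[OF j] by (simp add: N.prob_space)
    finally show ?thesis .
  qed
  have Ell: "(\<integral>x. ?l j x * ?l k x \<partial>?P) = (1 + (\<integral>x. \<delta> j x * \<delta> k x \<partial>N)) ^ card I"
    if jk: "j < M" "k < M" for j k
  proof -
    have "(\<integral>x. ?l j x * ?l k x \<partial>?P)
        = (\<integral>x. (\<Prod>i\<in>I. 1 + \<delta> j (x i) + \<delta> k (x i) + \<delta> j (x i) * \<delta> k (x i)) \<partial>?P)"
      by (simp add: prod.distrib[symmetric] algebra_simps)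
    also have "\<dots> = (\<Prod>i\<in>I. \<integral>x. 1 + \<delta> j x + \<delta> k x + \<delta> j x * \<delta> k x \<partial>N)"
      by (rule P.product_integral_prod[OF I]) (use int_N[OF jk] int_N[OF jk(2,1)] in auto)
    also have "\<dots> = (1 + (\<integral>x. \<delta> j x * \<delta> k x \<partial>N)) ^ card I"
      using int_N[OF jk] int_N[OF jk(2,1)] mean jk by (simp add: N.prob_space)
    finally show ?thesis .
  qed
  have Ell_le: "(\<integral>x. ?l j x * ?l k x \<partial>?P) \<le> 1 + (if j = k then (1 + \<rho>) ^ card I else 0)"
    if jk: "j < M" "k < M" for j k
  proof (cases "j = k")
    case True
    have "(1 + (\<integral>x. \<delta> j x * \<delta> j x \<partial>N)) ^ card I \<le> (1 + \<rho>) ^ card I"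
      using var[OF jk(1)] by (intro power_mono) (auto simp: power2_eq_square)
    then show ?thesis using True Ell[OF jk] by simp
  next
    case False
    then show ?thesis using Ell[OF jk] disj[OF jk False] by simp
  qed
  have int_q: "integrable ?P q" "integrable ?P (\<lambda>x. (q x)\<^sup>2)"
  proof -
    show "integrable ?P q" using q_meas q0 q2 by (intro P.integrable_const_bound[of _ "2^card I"]) auto
    have "(q x)\<^sup>2 \<le> (2^card I)\<^sup>2" for x by (rule power_mono[OF q2 q0])
    then show "integrable ?P (\<lambda>x. (q x)\<^sup>2)"
      using q_meas by (intro P.integrable_const_bound[of _ "(2^card I)\<^sup>2"]) auto
  qed
  have Eq: "(\<integral>x. q x \<partial>?P) = 1"
    unfolding q_def using int_l El M by simp
  have "(\<integral>x. (q x)\<^sup>2 \<partial>?P) = (\<integral>x. (\<Sum>j<M. \<Sum>k<M. ?l j x * ?l k x) / (real M)\<^sup>2 \<partial>?P)"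
    unfolding q_def by (simp add: power_divide power2_eq_square sum_product)
  also have "\<dots> = (\<Sum>j<M. \<Sum>k<M. \<integral>x. ?l j x * ?l k x \<partial>?P) / (real M)\<^sup>2"
  proof -
    have "(\<integral>x. (\<Sum>j<M. \<Sum>k<M. ?l j x * ?l k x) \<partial>?P)
        = (\<Sum>j<M. \<integral>x. (\<Sum>k<M. ?l j x * ?l k x) \<partial>?P)"
      by (intro Bochner_Integration.integral_sum Bochner_Integration.integrable_sum int_l(2)) auto
    also have "\<dots> = (\<Sum>j<M. \<Sum>k<M. \<integral>x. ?l j x * ?l k x \<partial>?P)"
      by (intro sum.cong refl Bochner_Integration.integral_sum int_l(2)) auto
    finally show ?thesis by simp
  qed
  also have "\<dots> \<le> (\<Sum>j<M. \<Sum>k<M. 1 + (if j = k then (1 + \<rho>) ^ card I else 0)) / (real M)\<^sup>2"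
    by (intro divide_right_mono sum_mono Ell_le) auto
  also have "\<dots> = 1 + (1 + \<rho>) ^ card I / real M"
    using M by (simp add: sum.distrib power2_eq_square field_simps)
  also have "\<dots> \<le> 5/4" using small M by (simp add: field_simps)
  finally have Eq2: "(\<integral>x. (q x)\<^sup>2 \<partial>?P) \<le> 5/4" .
  have "(\<integral>x. (q x - 1)\<^sup>2 \<partial>?P) = (\<integral>x. (q x)\<^sup>2 - 2 * q x + 1 \<partial>?P)"
    by (simp add: power2_diff algebra_simps)
  also have "\<dots> = (\<integral>x. (q x)\<^sup>2 \<partial>?P) - 2 * (\<integral>x. q x \<partial>?P) + 1"
    using int_q by (simp add: P1)
  finally show "(\<integral>x. (q x - 1)\<^sup>2 \<partial>?P) \<le> 1/4" using Eq Eq2 by simp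
qed

text \<open>
  The event \<open>B j\<close> is to be read as "the data speak for the \<open>j\<close>-th alternative". With \<open>U\<close>
  the union of the \<open>B j\<close>, the sum of the error under the null and of the average error
  under the alternatives is at least \<open>\<integral>(1\<^sub>U + q (1 - 1\<^sub>U))\<close>, and this is at least \<open>1/2\<close> because \<open>q\<close> is
  close to \<open>1\<close> in mean square. Hence one of the errors is at least \<open>1/4\<close>.
\<close>

lemma many_hypotheses_testing:
  fixes \<delta> :: "nat \<Rightarrow> 'a \<Rightarrow> real"
  assumes N: "prob_space N" and I: "finite I" and M: "0 < M"
    and \<delta>_meas: "\<And>j. j < M \<Longrightarrow> \<delta> j \<in> borel_measurable N"
    and \<delta>_bound: "\<And>j x. j < M \<Longrightarrow> \<bar>\<delta> j x\<bar> \<le> 1"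
    and prob: "\<And>j. j < M \<Longrightarrow> prob_space (density N (\<lambda>x. ennreal (1 + \<delta> j x)))"
    and var: "\<And>j. j < M \<Longrightarrow> (\<integral>x. (\<delta> j x)\<^sup>2 \<partial>N) \<le> \<rho>"
    and disj: "\<And>j k x. \<lbrakk>j < M; k < M; j \<noteq> k\<rbrakk> \<Longrightarrow> \<delta> j x * \<delta> k x = 0"
    and small: "4 * (1 + \<rho>) ^ card I \<le> real M"
    and B: "\<And>j. j < M \<Longrightarrow> B j \<in> sets (\<Pi>\<^sub>M i\<in>I. N)"
  shows "ennreal (1/4) \<le> emeasure (\<Pi>\<^sub>M i\<in>I. N) (\<Union>j<M. B j) \<or>
    (\<exists>j<M. ennreal (1/4) \<le> emeasure (\<Pi>\<^sub>M i\<in>I. density N (\<lambda>x. ennreal (1 + \<delta> j x)))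
       (space (\<Pi>\<^sub>M i\<in>I. N) - B j))"
proof -
  interpret N: prob_space N by fact
  interpret P: product_prob_space "\<lambda>i. N" "I"
    by (rule product_prob_spaceI) fact
  let ?P = "\<Pi>\<^sub>M i\<in>I. N"
  have P1: "measure ?P (space ?P) = 1"
    by (intro prob_space.prob_space prob_space_PiM N)
  let ?l = "\<lambda>j x. \<Prod>i\<in>I. 1 + \<delta> j (x i)"
  define q where "q = (\<lambda>x. (\<Sum>j<M. ?l j x) / real M)"
  have mean: "(\<integral>x. \<delta> j x \<partial>N) = 0" if j: "j < M" for j
  proof -
    note [measurable] = \<delta>_meas[OF j]
    have nn: "0 \<le> 1 + \<delta> j x" for x using \<delta>_bound[OF j, of x] by auto
    have int: "integrable N (\<delta> j)" using \<delta>_bound[OF j] by (intro N.integrable_const_bound[of _ 1]) auto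
    interpret D: prob_space "density N (\<lambda>x. ennreal (1 + \<delta> j x))" by (rule prob[OF j])
    have "(\<integral>\<^sup>+x. ennreal (1 + \<delta> j x) \<partial>N) = 1"
      using D.emeasure_space_1 by (simp add: emeasure_density cong: nn_integral_cong)
    then have "(\<integral>x. 1 + \<delta> j x \<partial>N) = 1"
      using nn by (intro integral_eq_nn_integral[THEN trans]) auto
    then show ?thesis using int by (simp add: N.prob_space)
  qed
  have q_meas: "q \<in> borel_measurable ?P" and q0: "\<And>x. 0 \<le> q x" and q2: "\<And>x. q x \<le> 2 ^ card I"
    and chi2: "(\<integral>x. (q x - 1)\<^sup>2 \<partial>?P) \<le> 1/4"
    using mixture_second_moment[OF N I M \<delta>_meas \<delta>_bound mean var disj small] unfolding q_def by auto
  note [measurable] = q_meas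
  define U where "U = (\<Union>j<M. B j)"
  have U[measurable]: "U \<in> sets ?P" unfolding U_def using B by auto
  have l_meas: "?l j \<in> borel_measurable ?P" if "j < M" for j
    using \<delta>_meas[OF that] by measurable
  have l01: "0 \<le> 1 + \<delta> j x" "1 + \<delta> j x \<le> 2" if "j < M" for j x
    using \<delta>_bound[OF that, of x] by auto
  have l_nn: "0 \<le> ?l j x" if "j < M" for j x
    by (rule prod_nonneg) (use l01[OF that] in auto)
  have l_bd: "?l j x \<le> 2 ^ card I" if "j < M" for j x
  proof -
    have "?l j x \<le> (\<Prod>i\<in>I. 2)"
      by (rule prod_mono) (use l01[OF that] in auto)
    then show ?thesis by simp
  qed
  have alt: "emeasure (\<Pi>\<^sub>M i\<in>I. density N (\<lambda>x. ennreal (1 + \<delta> j x))) (space ?P - U)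
     = ennreal (\<integral>x. ?l j x * indicator (space ?P - U) x \<partial>?P)" if j: "j < M" for j
  proof -
    note [measurable] = \<delta>_meas[OF j] l_meas[OF j]
    have nn: "0 \<le> 1 + \<delta> j x" for x using \<delta>_bound[OF j, of x] by auto
    have "(\<Pi>\<^sub>M i\<in>I. density N (\<lambda>x. ennreal (1 + \<delta> j x)))
        = density ?P (\<lambda>x. \<Prod>i\<in>I. ennreal (1 + \<delta> j (x i)))"
      by (rule PiM_density[OF N I]) (auto intro: prob[OF j])
    also have "\<dots> = density ?P (\<lambda>x. ennreal (?l j x))"
      by (simp add: prod_ennreal nn)
    finally have "emeasure (\<Pi>\<^sub>M i\<in>I. density N (\<lambda>x. ennreal (1 + \<delta> j x))) (space ?P - U)
      = (\<integral>\<^sup>+x. ennreal (?l j x) * indicator (space ?P - U) x \<partial>?P)"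
      by (simp add: emeasure_density)
    also have "\<dots> = (\<integral>\<^sup>+x. ennreal (?l j x * indicator (space ?P - U) x) \<partial>?P)"
      by (intro nn_integral_cong) (auto simp: indicator_def)
    also have "\<dots> = ennreal (\<integral>x. ?l j x * indicator (space ?P - U) x \<partial>?P)"
    proof (rule nn_integral_eq_integral)
      show "integrable ?P (\<lambda>x. ?l j x * indicator (space ?P - U) x)"
        using l_nn[OF j] l_bd[OF j]
        by (intro P.integrable_const_bound[of _ "2^card I"]) (auto simp: indicator_def)
      show "AE x in ?P. 0 \<le> ?l j x * indicator (space ?P - U) x"
        using l_nn[OF j] by (auto simp: indicator_def)
    qed
    finally show ?thesis .
  qed
  have int_lU: "integrable ?P (\<lambda>x. ?l j x * indicator (space ?P - U) x)" if "j < M" for j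
    using l_nn[OF that] l_bd[OF that] l_meas[OF that]
    by (intro P.integrable_const_bound[of _ "2^card I"]) (auto simp: indicator_def)
  \<comment> \<open>Pointwise, both \<open>1\<close> and \<open>q\<close> dominate \<open>3/4 - (q - 1)\<^sup>2\<close>, whose mean is at least \<open>1/2\<close>.\<close>
  have key: "1/2 \<le> measure ?P U + (\<integral>x. q x * indicator (space ?P - U) x \<partial>?P)"
  proof -
    have i1: "integrable ?P (\<lambda>x. (q x - 1)\<^sup>2)"
    proof (intro P.integrable_const_bound[of _ "(2^card I + 1)\<^sup>2"] AE_I2)
      fix x
      have "\<bar>q x - 1\<bar> \<le> \<bar>2^card I + 1\<bar>" using q0[of x] q2[of x] by auto
      then show "norm ((q x - 1)\<^sup>2) \<le> (2 ^ card I + 1)\<^sup>2"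
        unfolding abs_le_square_iff by simp
    qed simp
    have i2: "integrable ?P (\<lambda>x. q x * indicator (space ?P - U) x)"
      using q0 q2 by (intro P.integrable_const_bound[of _ "2^card I"]) (auto simp: indicator_def)
    have i3: "integrable ?P (indicat_real U)" by (simp add: less_top[symmetric])
    have "1/2 \<le> 3/4 - (\<integral>x. (q x - 1)\<^sup>2 \<partial>?P)" using chi2 by simp
    also have "\<dots> = (\<integral>x. 3/4 - (q x - 1)\<^sup>2 \<partial>?P)" using i1 by (simp add: P1)
    also have "\<dots> \<le> (\<integral>x. indicat_real U x + q x * indicator (space ?P - U) x \<partial>?P)"
    proof (rule integral_mono)
      fix x assume x: "x \<in> space ?P"
      \<comment> \<open>\<open>q - (3/4 - (q - 1)\<^sup>2) = (q - 1/2)\<^sup>2\<close>\<close>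
      have "0 \<le> (q x - 1/2)\<^sup>2" by simp
      then have "3/4 - (q x - 1)\<^sup>2 \<le> q x" by (simp add: power2_eq_square algebra_simps)
      moreover have "3/4 - (q x - 1)\<^sup>2 \<le> 1" using zero_le_power2[of "q x - 1"] by linarith
      ultimately show "3/4 - (q x - 1)\<^sup>2 \<le> indicat_real U x + q x * indicator (space ?P - U) x"
        using x by (auto simp: indicator_def)
    qed (use i1 i2 i3 in auto)
    also have "\<dots> = measure ?P U + (\<integral>x. q x * indicator (space ?P - U) x \<partial>?P)"
      using i2 i3 by simp
    finally show ?thesis .
  qed
  show ?thesis
  proof (cases "1/4 \<le> measure ?P U")
    case True
    then show ?thesis by (simp add: U_def P.emeasure_eq_measure)
  next
    case False
    have "\<exists>j<M. 1/4 \<le> (\<integral>x. ?l j x * indicator (space ?P - U) x \<partial>?P)"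
    proof (rule ccontr)
      assume "\<not> ?thesis"
      then have lt: "(\<integral>x. ?l j x * indicator (space ?P - U) x \<partial>?P) \<le> 1/4" if "j < M" for j
        using that by force
      have "(\<integral>x. q x * indicator (space ?P - U) x \<partial>?P)
          = (\<integral>x. (\<Sum>j<M. ?l j x * indicator (space ?P - U) x) / real M \<partial>?P)"
        unfolding q_def by (simp add: sum_distrib_right)
      also have "\<dots> = (\<Sum>j<M. \<integral>x. ?l j x * indicator (space ?P - U) x \<partial>?P) / real M"
        unfolding integral_divide_zero
        by (subst Bochner_Integration.integral_sum) (use int_lU in blast, rule refl)
      also have "\<dots> \<le> (\<Sum>j<M. 1/4) / real M"
        by (intro divide_right_mono sum_mono lt) auto
      also have "\<dots> = 1/4" using M by simp
      finally show False using key False by simp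
    qed
    then obtain j where j: "j < M" "1/4 \<le> (\<integral>x. ?l j x * indicator (space ?P - U) x \<partial>?P)" by auto
    have s: "sets (\<Pi>\<^sub>M i\<in>I. density N (\<lambda>x. ennreal (1 + \<delta> j x))) = sets ?P"
      by (simp cong: sets_PiM_cong)
    have "ennreal (1/4) \<le> emeasure (\<Pi>\<^sub>M i\<in>I. density N (\<lambda>x. ennreal (1 + \<delta> j x))) (space ?P - U)"
      unfolding alt[OF j(1)] using j(2) by (rule ennreal_leI)
    also have "\<dots> \<le> emeasure (\<Pi>\<^sub>M i\<in>I. density N (\<lambda>x. ennreal (1 + \<delta> j x))) (space ?P - B j)"
      by (rule emeasure_mono) (use j(1) B s in \<open>auto simp: U_def\<close>)
    finally show ?thesis using j(1) by blast
  qed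
qed

section \<open>Diagrams with at most one point\<close>

definition point_diagram :: "real \<times> real \<Rightarrow> diagram" where
  "point_diagram u = (\<lambda>x. if x = u then 1 else 0)"

lemma nn_integral_diagram_measure:
  assumes "f \<in> borel_measurable borel"
  shows "(\<integral>\<^sup>+x. f x \<partial>diagram_measure D) = (\<integral>\<^sup>+x. of_nat (D x) * f x \<partial>count_space UNIV)"
  unfolding diagram_measure_def using assms
  by (subst nn_integral_distr) (auto simp: nn_integral_density)

lemma sets_diagram_measure [simp, measurable_cong]: "sets (diagram_measure D) = sets borel"
  by (simp add: diagram_measure_def)

lemma space_diagram_measure [simp]: "space (diagram_measure D) = UNIV"
  by (simp add: diagram_measure_def)

lemma nn_integral_empty_diagram:
  assumes "f \<in> borel_measurable borel"
  shows "(\<integral>\<^sup>+x. f x \<partial>diagram_measure (\<lambda>_. 0)) = 0"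
  using assms by (simp add: nn_integral_diagram_measure)

lemma nn_integral_point_diagram:
  assumes "f \<in> borel_measurable borel"
  shows "(\<integral>\<^sup>+x. f x \<partial>diagram_measure (point_diagram u)) = f u"
proof -
  have "(\<integral>\<^sup>+x. f x \<partial>diagram_measure (point_diagram u))
      = (\<integral>\<^sup>+x. f x * indicator {u} x \<partial>count_space UNIV)"
    unfolding nn_integral_diagram_measure[OF assms]
    by (intro nn_integral_cong) (auto simp: point_diagram_def)
  then show ?thesis by (subst (asm) nn_integral_indicator_singleton) auto
qed

lemma emeasure_empty_diagram:
  "A \<in> sets borel \<Longrightarrow> emeasure (diagram_measure (\<lambda>_. 0)) A = 0"
  using nn_integral_empty_diagram[of "indicator A"] by simp

lemma emeasure_point_diagram:
  "A \<in> sets borel \<Longrightarrow> emeasure (diagram_measure (point_diagram u)) A = indicator A u"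
  using nn_integral_point_diagram[of "indicator A"] by simp

lemma space_diagram_space [simp]: "space (diagram_space L) = diagrams L"
  unfolding diagram_space_def by (intro space_measure_of) auto

lemma empty_in_diagrams: "(\<lambda>_. 0) \<in> diagrams L"
  by (auto simp: diagrams_def emeasure_empty_diagram compact_imp_closed borel_closed)

lemma point_in_diagrams: "u \<in> open_triangle L \<Longrightarrow> point_diagram u \<in> diagrams L"
  unfolding diagrams_def
  by (auto simp: emeasure_point_diagram compact_imp_closed borel_closed indicator_def)
     (auto simp: point_diagram_def split: if_splits)

lemma measurable_emeasure_diagram:
  assumes "A \<in> sets borel"
  shows "(\<lambda>D. emeasure (diagram_measure D) A) \<in> borel_measurable (diagram_space L)"
proof (rule measurableI)
  fix B :: "ennreal set" assume "B \<in> sets borel"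
  then show "(\<lambda>D. emeasure (diagram_measure D) A) -` B \<inter> space (diagram_space L)
      \<in> sets (diagram_space L)"
    using assms unfolding space_diagram_space unfolding diagram_space_def
    by (subst sets_measure_of) (auto intro!: sigma_sets.Basic)
qed auto

text \<open>
  The \<open>\<sigma>\<close>-algebra on diagrams only makes the evaluations at Borel sets measurable by fiat; integrals
  of Borel functions follow by approximation with simple functions.
\<close>

lemma measurable_nn_integral_diagram:
  assumes "f \<in> borel_measurable borel"
  shows "(\<lambda>D. \<integral>\<^sup>+x. f x \<partial>diagram_measure D) \<in> borel_measurable (diagram_space L)"
  using assms
proof (induction rule: borel_measurable_induct)
  case (cong f g)
  then have "f = g" by auto
  then show ?case using cong by simp
next
  case (set A)
  then show ?case using measurable_emeasure_diagram[OF set] by simp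
next
  case (mult u c)
  then show ?case by (simp add: nn_integral_cmult)
next
  case (add u v)
  then show ?case by (simp add: nn_integral_add)
next
  case (seq U)
  have "(\<integral>\<^sup>+x. (SUP i. U i) x \<partial>diagram_measure D) = (SUP i. \<integral>\<^sup>+x. U i x \<partial>diagram_measure D)" for D
    unfolding SUP_apply using seq by (intro nn_integral_monotone_convergence_SUP) auto
  then show ?case using seq by (simp add: borel_measurable_SUP)
qed

lemma measurable_thinned_point:
  assumes "K \<in> sets borel" "K \<subseteq> open_triangle L"
    and [measurable]: "k \<in> measurable M (count_space UNIV)" "v \<in> borel_measurable M"
  shows "(\<lambda>x. if k x \<and> v x \<in> K then point_diagram (v x) else (\<lambda>_. 0)) \<in> measurable M (diagram_space L)"
  unfolding diagram_space_def
proof (rule measurable_measure_of)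
  note [measurable] = assms(1)
  let ?f = "\<lambda>x. if k x \<and> v x \<in> K then point_diagram (v x) else (\<lambda>_. 0)"
  show dg: "?f \<in> space M \<rightarrow> diagrams L"
    using assms(2) by (intro Pi_I) (metis point_in_diagrams empty_in_diagrams subsetD)
  fix y assume "y \<in> {(\<lambda>D. emeasure (diagram_measure D) A) -` B \<inter> diagrams L | A B.
        A \<in> sets borel \<and> B \<in> sets borel}"
  then obtain A and B :: "ennreal set" where y: "y = (\<lambda>D. emeasure (diagram_measure D) A) -` B \<inter> diagrams L"
    and [measurable]: "A \<in> sets borel" "B \<in> sets borel" by auto
  have "emeasure (diagram_measure (?f x)) A = (if k x \<and> v x \<in> K then indicator A (v x) else 0)" for x
    by (simp add: emeasure_point_diagram emeasure_empty_diagram)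
  then have "?f -` y \<inter> space M
      = (\<lambda>x. if k x \<and> v x \<in> K then indicator A (v x) else 0) -` B \<inter> space M"
    using dg unfolding y by auto
  also have "\<dots> \<in> sets M" by measurable
  finally show "?f -` y \<inter> space M \<in> sets M" .
qed auto

lemma unit_cube_eq_cbox: "(unit_cube :: (real ^ 'd) set) = cbox 0 1"
  by (auto simp: unit_cube_def mem_box_cart)

lemma emeasure_unit_cube: "emeasure lborel (unit_cube :: (real ^ 'd) set) = 1"
proof -
  have "(1 :: real ^ 'd) \<bullet> b = 1" if "b \<in> Basis" for b
    using that by (auto simp: Basis_vec_def inner_axis)
  then show ?thesis unfolding unit_cube_eq_cbox by (subst emeasure_lborel_cbox) auto
qed

lemma unit_cube_borel [measurable]: "(unit_cube :: (real ^ 'd) set) \<in> sets borel"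
  by (simp add: unit_cube_eq_cbox)

lemma closed_triangle_borel [measurable]: "closed_triangle L \<in> sets borel"
proof -
  have "closed_triangle L = {u. 0 \<le> fst u} \<inter> {u. fst u \<le> snd u} \<inter> {u. snd u \<le> L}"
    by (auto simp: closed_triangle_def)
  also have "closed \<dots>" by (intro closed_Int closed_Collect_le continuous_intros)
  finally show ?thesis by (rule borel_closed)
qed

lemma open_subset_closed_triangle: "open_triangle L \<subseteq> closed_triangle L"
  by (auto simp: open_triangle_def closed_triangle_def)

lemma measurable_weighted_mass:
  assumes "continuous_on (closed_triangle L) w" "A \<in> sets borel" "A \<subseteq> closed_triangle L"
  shows "(\<lambda>u. ennreal (w u) * indicator A u) \<in> borel_measurable borel"
    and "(\<lambda>D. weighted_mass w D A) \<in> borel_measurable (diagram_space L')"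
proof -
  have "(\<lambda>u. indicator A u *\<^sub>R w u) \<in> borel_measurable borel"
    by (rule borel_measurable_continuous_on_indicator)
       (use assms continuous_on_subset in auto)
  then have [measurable]: "(\<lambda>u. indicator A u * w u) \<in> borel_measurable borel" by simp
  have "(\<lambda>u. ennreal (w u) * indicator A u) = (\<lambda>u. ennreal (indicator A u * w u))"
    by (auto simp: indicator_def)
  then show m: "(\<lambda>u. ennreal (w u) * indicator A u) \<in> borel_measurable borel" by simp
  show "(\<lambda>D. weighted_mass w D A) \<in> borel_measurable (diagram_space L')"
    unfolding weighted_mass_def by (rule measurable_nn_integral_diagram[OF m])
qed

section \<open>A thinned uniform point as a model law\<close>

text \<open>
  The latent randomness behind an observation: a covariate \<open>z\<close>, a point \<open>u\<close> uniform on \<open>K\<close>, and a mark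
  telling whether the point is kept, which happens with probability \<open>p z u\<close>. The total mass is
  \<open>p + (1 - p) = 1\<close> whatever \<open>p\<close> is, within \<open>[0, 1]\<close>, so that perturbing \<open>p\<close> needs no renormalisation. Formulating
  the testing problem on this space instead of on diagrams gives likelihood ratios in closed form.
\<close>

definition marked_points :: "(real \<times> real) set \<Rightarrow> (real ^ 'd \<Rightarrow> real \<times> real \<Rightarrow> real) \<Rightarrow>
    (((real ^ 'd) \<times> (real \<times> real)) \<times> bool) measure" where
  "marked_points K p = density
     ((uniform_measure lborel unit_cube \<Otimes>\<^sub>M uniform_measure lborel K) \<Otimes>\<^sub>M count_space UNIV)
     (\<lambda>((z, u), b). ennreal (if b then p z u else 1 - p z u))"

text \<open>
  The test \<open>u \<in> K\<close> makes the image a diagram supported off the diagonal for every argument, not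
  only for almost every one.
\<close>

definition thinned_observation :: "(real \<times> real) set \<Rightarrow>
    ((real ^ 'd) \<times> (real \<times> real)) \<times> bool \<Rightarrow> (real ^ 'd) \<times> diagram" where
  "thinned_observation K = (\<lambda>((z, u), b). (z, if b \<and> u \<in> K then point_diagram u else (\<lambda>_. 0)))"

lemma sets_marked_points [measurable_cong]:
  "sets (marked_points K p) = sets ((borel \<Otimes>\<^sub>M borel) \<Otimes>\<^sub>M count_space UNIV)"
  unfolding marked_points_def sets_density by (intro sets_pair_measure_cong) auto

lemma nn_integral_marked_points:
  fixes f :: "((real ^ 'd) \<times> (real \<times> real)) \<times> bool \<Rightarrow> ennreal"
  assumes [measurable]: "case_prod p \<in> borel_measurable (borel \<Otimes>\<^sub>M borel)"
    "f \<in> borel_measurable ((borel \<Otimes>\<^sub>M borel) \<Otimes>\<^sub>M count_space UNIV)"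
    and K: "K \<in> sets borel" "emeasure lborel K \<noteq> 0" "emeasure lborel K \<noteq> \<infinity>"
  shows "(\<integral>\<^sup>+x. f x \<partial>marked_points K p) =
    (\<integral>\<^sup>+z. \<integral>\<^sup>+u. (ennreal (p z u) * f ((z, u), True) + ennreal (1 - p z u) * f ((z, u), False))
       \<partial>uniform_measure lborel K \<partial>uniform_measure lborel unit_cube)"
proof -
  let ?C = "uniform_measure lborel unit_cube :: (real ^ 'd) measure"
  let ?U = "uniform_measure lborel K"
  interpret C: prob_space ?C by (rule prob_space_uniform_measure) (auto simp: emeasure_unit_cube)
  interpret U: prob_space ?U by (rule prob_space_uniform_measure) (use K in auto)
  interpret CU: pair_prob_space ?C ?U ..
  interpret B: sigma_finite_measure "count_space (UNIV :: bool set)"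
    by (rule sigma_finite_measure_count_space)
  have [measurable_cong]: "sets ?C = sets borel" "sets ?U = sets borel" by auto
  have [measurable]: "(\<lambda>x. p (fst x) (snd x)) \<in> borel_measurable (borel \<Otimes>\<^sub>M borel)"
    using assms(1) by (simp add: case_prod_beta')
  have m1: "(\<lambda>((z, u), b). ennreal (if b then p z u else 1 - p z u))
      \<in> borel_measurable ((?C \<Otimes>\<^sub>M ?U) \<Otimes>\<^sub>M count_space UNIV)"
    unfolding case_prod_beta' by measurable
  have m2: "f \<in> borel_measurable ((?C \<Otimes>\<^sub>M ?U) \<Otimes>\<^sub>M count_space UNIV)"
    by measurable
  have "(\<integral>\<^sup>+x. f x \<partial>marked_points K p) =
     (\<integral>\<^sup>+x. (\<lambda>((z, u), b). ennreal (if b then p z u else 1 - p z u)) x * f x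
        \<partial>((?C \<Otimes>\<^sub>M ?U) \<Otimes>\<^sub>M count_space UNIV))"
    unfolding marked_points_def by (rule nn_integral_density[OF m1 m2])
  also have "\<dots> = (\<integral>\<^sup>+y. \<integral>\<^sup>+b. (\<lambda>((z, u), b). ennreal (if b then p z u else 1 - p z u)) (y, b) * f (y, b)
        \<partial>count_space UNIV \<partial>(?C \<Otimes>\<^sub>M ?U))"
    by (rule B.nn_integral_fst[symmetric]) (intro borel_measurable_times_ennreal m1 m2)
  also have "\<dots> = (\<integral>\<^sup>+y. (ennreal (p (fst y) (snd y)) * f (y, True)
        + ennreal (1 - p (fst y) (snd y)) * f (y, False)) \<partial>(?C \<Otimes>\<^sub>M ?U))"
    by (simp add: nn_integral_count_space_finite UNIV_bool case_prod_beta' add.commute)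
  also have "\<dots> = (\<integral>\<^sup>+z. \<integral>\<^sup>+u. (ennreal (p z u) * f ((z, u), True) + ennreal (1 - p z u) * f ((z, u), False))
       \<partial>?U \<partial>?C)"
    by (subst U.nn_integral_fst[symmetric]) simp_all
  finally show ?thesis .
qed

text \<open>
  Diagrams with at most one point, located in a fixed open set \<open>K\<close> off the diagonal. They are rich
  enough to realise every sufficiently small density supported in \<open>K\<close>. The upper bound on \<open>w\<close> is the
  mass bound of the model, since a single point \<open>u\<close> has weighted mass \<open>w u\<close>.
\<close>

locale thinned_point_model =
  fixes L Mw :: real and w :: "real \<times> real \<Rightarrow> real" and K :: "(real \<times> real) set"
  assumes w_cont: "continuous_on (closed_triangle L) w"
    and K_open: "open K" and K_nonempty: "K \<noteq> {}" and K_sub: "K \<subseteq> open_triangle L"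
    and w_pos: "\<And>u. u \<in> K \<Longrightarrow> 0 < w u" and w_le: "\<And>u. u \<in> K \<Longrightarrow> w u \<le> Mw"
begin

lemma K_borel [measurable]: "K \<in> sets borel"
  using K_open by simp

lemma K_sub_closed: "K \<subseteq> closed_triangle L"
  using K_sub open_subset_closed_triangle by blast

lemma K_measure: "emeasure lborel K = ennreal (measure lborel K)" "0 < measure lborel K"
proof -
  have "K \<subseteq> cbox (0, 0) (L, L)"
    using K_sub by (auto simp: open_triangle_def mem_box Basis_prod_def)
  then have "bounded K" using bounded_cbox bounded_subset by blast
  then have fin: "emeasure lborel K < \<infinity>" by (rule emeasure_bounded_finite)
  then show eq: "emeasure lborel K = ennreal (measure lborel K)"
    by (simp add: emeasure_eq_ennreal_measure)
  have "emeasure lborel K \<noteq> 0"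
  proof
    assume "emeasure lborel K = 0"
    then have "K \<in> null_sets lborel" by auto
    then have "negligible K" using negligible_iff_null_sets null_sets_completionI by blast
    then show False using K_open K_nonempty open_not_negligible by blast
  qed
  then show "0 < measure lborel K" unfolding eq by (simp add: zero_less_measure_iff)
qed

lemma K_emeasure: "emeasure lborel K \<noteq> 0" "emeasure lborel K \<noteq> \<infinity>"
  using K_measure by auto

text \<open>
  The probability of keeping a point \<open>u\<close>, chosen so that the weight \<open>w\<close> and the density \<open>1 / |K|\<close> of
  the uniform law cancel and \<open>g\<close> remains as the weighted mean density.
\<close>

definition retention :: "(real ^ 'd \<Rightarrow> real \<times> real \<Rightarrow> real) \<Rightarrow> real ^ 'd \<Rightarrow> real \<times> real \<Rightarrow> real"
  where "retention g z u = (if u \<in> K then measure lborel K * g z u / w u else 0)"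

definition thinned_law ::
  "(real ^ 'd \<Rightarrow> real \<times> real \<Rightarrow> real) \<Rightarrow> ((real ^ 'd) \<times> diagram) measure"
  where "thinned_law g =
    distr (marked_points K (retention g)) (observation_space L) (thinned_observation K)"

text \<open>
  The last condition says that \<open>retention g\<close> is a probability.
\<close>

definition admissible :: "(real ^ 'd \<Rightarrow> real \<times> real \<Rightarrow> real) \<Rightarrow> bool" where
  "admissible g \<longleftrightarrow> case_prod g \<in> borel_measurable (borel \<Otimes>\<^sub>M borel) \<and>
     (\<forall>z u. 0 \<le> g z u \<and> (u \<notin> K \<longrightarrow> g z u = 0) \<and> (u \<in> K \<longrightarrow> measure lborel K * g z u \<le> w u))"

lemma admissibleD:
  assumes "admissible g"
  shows "0 \<le> g z u" "u \<notin> K \<Longrightarrow> g z u = 0" "u \<in> K \<Longrightarrow> measure lborel K * g z u \<le> w u"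
  using assms unfolding admissible_def by blast+

lemma w_meas: "(\<lambda>u. indicator K u * w u) \<in> borel_measurable borel"
  using borel_measurable_continuous_on_indicator[OF K_borel continuous_on_subset[OF w_cont K_sub_closed]]
  by simp

lemma retention_measurable:
  assumes "admissible g"
  shows "case_prod (retention g) \<in> borel_measurable (borel \<Otimes>\<^sub>M borel)"
proof -
  note [measurable] = w_meas
  have [measurable]: "(\<lambda>x. g (fst x) (snd x)) \<in> borel_measurable (borel \<Otimes>\<^sub>M borel)"
    using assms by (simp add: admissible_def case_prod_beta')
  have "case_prod (retention g)
      = (\<lambda>x. measure lborel K * g (fst x) (snd x) / (indicator K (snd x) * w (snd x)))"
    by (auto simp: retention_def fun_eq_iff)
  then show ?thesis by simp
qed

lemma retention_bounds:
  assumes "admissible g"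
  shows "0 \<le> retention g z u" "retention g z u \<le> 1"
  using admissibleD[OF assms, where z = z and u = u] w_pos[of u] K_measure(2)
  by (auto simp: retention_def)

lemma nn_integral_thinned_points:
  fixes f :: "((real ^ 'd) \<times> (real \<times> real)) \<times> bool \<Rightarrow> ennreal"
  assumes "admissible g" "f \<in> borel_measurable ((borel \<Otimes>\<^sub>M borel) \<Otimes>\<^sub>M count_space UNIV)"
  shows "(\<integral>\<^sup>+x. f x \<partial>marked_points K (retention g)) =
    (\<integral>\<^sup>+z. \<integral>\<^sup>+u. (ennreal (retention g z u) * f ((z, u), True)
        + ennreal (1 - retention g z u) * f ((z, u), False))
       \<partial>uniform_measure lborel K \<partial>uniform_measure lborel unit_cube)"
  by (rule nn_integral_marked_points[OF retention_measurable[OF assms(1)] assms(2) K_borel K_emeasure])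

text \<open>
  Functions of covariate and point that ignore the mark do not see \<open>g\<close>: covariate and point are
  independent and uniform under every hypothesis.
\<close>

lemma nn_integral_thinned_points_unmarked:
  fixes f :: "(real ^ 'd) \<times> (real \<times> real) \<Rightarrow> ennreal"
  assumes "admissible g" and [measurable]: "f \<in> borel_measurable (borel \<Otimes>\<^sub>M borel)"
  shows "(\<integral>\<^sup>+x. f (fst x) \<partial>marked_points K (retention g)) =
    (\<integral>\<^sup>+z. \<integral>\<^sup>+u. f (z, u) \<partial>uniform_measure lborel K \<partial>uniform_measure lborel unit_cube)"
proof -
  have "ennreal (retention g z u) * a + ennreal (1 - retention g z u) * a = a" for z u a
    using retention_bounds[OF assms(1), of z u]
    by (simp flip: distrib_right ennreal_plus)
  then show ?thesis
    using assms(1) by (subst nn_integral_thinned_points) simp_all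
qed

lemma prob_space_uniform_K: "prob_space (uniform_measure lborel K)"
  by (rule prob_space_uniform_measure) (use K_emeasure in auto)

lemma prob_space_uniform_cube: "prob_space (uniform_measure lborel (unit_cube :: (real ^ 'd) set))"
  by (rule prob_space_uniform_measure) (auto simp: emeasure_unit_cube)

lemma prob_space_thinned_points:
  assumes "admissible (g :: real ^ 'd \<Rightarrow> _)"
  shows "prob_space (marked_points K (retention g))"
proof
  interpret C: prob_space "uniform_measure lborel (unit_cube :: (real ^ 'd) set)"
    by (rule prob_space_uniform_cube)
  interpret U: prob_space "uniform_measure lborel K" by (rule prob_space_uniform_K)
  have "emeasure (marked_points K (retention g)) (space (marked_points K (retention g)))
      = (\<integral>\<^sup>+x. 1 \<partial>marked_points K (retention g))" by simp
  also have "\<dots> = 1"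
    using nn_integral_thinned_points_unmarked[OF assms, of "\<lambda>_. 1"]
      C.emeasure_space_1 U.emeasure_space_1 by simp
  finally show "emeasure (marked_points K (retention g)) (space (marked_points K (retention g))) = 1" .
qed

lemma thinned_observation_measurable:
  "thinned_observation K \<in> measurable ((borel \<Otimes>\<^sub>M borel) \<Otimes>\<^sub>M count_space UNIV) (observation_space L)"
  unfolding thinned_observation_def observation_space_def case_prod_beta'
  by (intro measurable_Pair measurable_thinned_point[OF K_borel K_sub]) measurable

lemma thinned_observation_measurable' [measurable]:
  "thinned_observation K \<in> measurable (marked_points K p) (observation_space L)"
  using thinned_observation_measurable by (simp cong: measurable_cong_sets add: sets_marked_points)

lemma sets_thinned_law [simp, measurable_cong]: "sets (thinned_law g) = sets (observation_space L)"
  by (simp add: thinned_law_def)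

lemma prob_space_thinned_law: "admissible g \<Longrightarrow> prob_space (thinned_law g)"
  unfolding thinned_law_def
  by (intro prob_space.prob_space_distr prob_space_thinned_points) auto

lemma fst_thinned_law [measurable]: "fst \<in> measurable (thinned_law g) borel"
  by (subst measurable_cong_sets[OF sets_thinned_law refl]) (simp add: observation_space_def)

lemma weighted_mass_thinned_observation:
  assumes "A \<in> sets borel" "A \<subseteq> closed_triangle L"
  shows "weighted_mass w (snd (thinned_observation K ((z, u), b))) A
     = (if b \<and> u \<in> K then ennreal (w u) * indicator A u else 0)"
  using measurable_weighted_mass(1)[OF w_cont assms]
  by (simp add: thinned_observation_def weighted_mass_def nn_integral_point_diagram
      nn_integral_empty_diagram)

lemma distr_fst_thinned_law:
  assumes "admissible (g :: real ^ 'd \<Rightarrow> _)"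
  shows "distr (thinned_law g) borel fst = uniform_measure lborel unit_cube"
proof (rule measure_eqI)
  interpret U: prob_space "uniform_measure lborel K" by (rule prob_space_uniform_K)
  fix S :: "(real ^ 'd) set" assume "S \<in> sets (distr (thinned_law g) borel fst)"
  then have [measurable]: "S \<in> sets borel" by simp
  have [measurable]: "(\<lambda>x. fst (fst x)) \<in> borel_measurable (marked_points K (retention g))"
    by measurable
  have "emeasure (distr (thinned_law g) borel fst) S
      = (\<integral>\<^sup>+\<omega>. indicator S (fst \<omega>) \<partial>thinned_law g)"
    by (subst nn_integral_indicator[symmetric], simp, subst nn_integral_distr) auto
  also have "\<dots> = (\<integral>\<^sup>+x. indicator S (fst (thinned_observation K x)) \<partial>marked_points K (retention g))"
    unfolding thinned_law_def
    by (subst nn_integral_distr[OF thinned_observation_measurable'])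
       (auto simp: observation_space_def)
  also have "\<dots> = (\<integral>\<^sup>+x. indicator S (fst (fst x)) \<partial>marked_points K (retention g))"
    by (simp add: thinned_observation_def case_prod_beta')
  also have "\<dots> = (\<integral>\<^sup>+z. \<integral>\<^sup>+u. indicator S z \<partial>uniform_measure lborel K \<partial>uniform_measure lborel unit_cube)"
    by (subst nn_integral_thinned_points_unmarked[OF assms]) simp_all
  also have "\<dots> = emeasure (uniform_measure lborel unit_cube) S"
    using U.emeasure_space_1 by (simp add: nn_integral_cmult)
  finally show "emeasure (distr (thinned_law g) borel fst) S
    = emeasure (uniform_measure lborel unit_cube) S" .
qed simp

lemma nn_integral_fst_thinned_law:
  assumes "admissible (g :: real ^ 'd \<Rightarrow> _)" "f \<in> borel_measurable borel"
  shows "(\<integral>\<^sup>+\<omega>. f (fst \<omega>) \<partial>thinned_law g) = (\<integral>\<^sup>+z. f z \<partial>uniform_measure lborel unit_cube)"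
  using nn_integral_distr[OF fst_thinned_law, of f g] assms(2)
  by (simp add: distr_fst_thinned_law[OF assms(1)])

lemma nn_integral_retention:
  assumes g: "admissible g" and [measurable]: "A \<in> sets borel"
  shows "(\<integral>\<^sup>+u. ennreal (retention g z u) * (if u \<in> K then ennreal (w u) * indicator A u else 0)
      \<partial>uniform_measure lborel K) = (\<integral>\<^sup>+u. ennreal (g z u) * indicator A u \<partial>lborel)"
proof -
  have [measurable]: "g z \<in> borel_measurable borel"
    using g measurable_compose[OF measurable_Pair1'[of z borel borel], of "case_prod g" borel]
    by (simp add: admissible_def)
  have "ennreal (retention g z u) * (if u \<in> K then ennreal (w u) * indicator A u else 0)
      = ennreal (measure lborel K) * (ennreal (g z u) * indicator A u)" for u
  proof (cases "u \<in> K")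
    case True
    have "ennreal (retention g z u) * ennreal (w u) = ennreal (measure lborel K * g z u)"
      using True w_pos[OF True] retention_bounds(1)[OF g, of z u]
      by (subst ennreal_mult'[symmetric]) (auto simp: retention_def)
    also have "\<dots> = ennreal (measure lborel K) * ennreal (g z u)"
      using g by (intro ennreal_mult') (auto simp: admissible_def)
    finally show ?thesis using True by (simp add: mult.assoc[symmetric])
  next
    case False
    then show ?thesis using admissibleD(2)[OF g] by simp
  qed
  then have "(\<integral>\<^sup>+u. ennreal (retention g z u) * (if u \<in> K then ennreal (w u) * indicator A u else 0)
      \<partial>uniform_measure lborel K)
     = (\<integral>\<^sup>+u. ennreal (measure lborel K) * (ennreal (g z u) * indicator A u) * indicator K u \<partial>lborel)
       / emeasure lborel K"
    by (simp add: nn_integral_uniform_measure)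
  also have "(\<lambda>u. ennreal (measure lborel K) * (ennreal (g z u) * indicator A u) * indicator K u)
      = (\<lambda>u. ennreal (measure lborel K) * (ennreal (g z u) * indicator A u))"
    using admissibleD(2)[OF g] by (auto simp: fun_eq_iff indicator_def)
  also have "(\<integral>\<^sup>+u. ennreal (measure lborel K) * (ennreal (g z u) * indicator A u) \<partial>lborel)
      / emeasure lborel K = (\<integral>\<^sup>+u. ennreal (g z u) * indicator A u \<partial>lborel)"
    using K_measure by (subst nn_integral_cmult)
      (auto simp: mult.commute[of "ennreal (measure lborel K)"] ennreal_mult_divide_eq)
  finally show ?thesis .
qed

text \<open>
  By the characterisation of conditional expectations it suffices to integrate over the events
  \<open>fst \<in> S\<close>. There both sides become integrals over the latent space, and the cancellation of
  \<open>nn_integral_retention\<close> applies for each value of the covariate.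
\<close>

lemma nn_cond_exp_thinned_law:
  assumes g: "admissible (g :: real ^ 'd \<Rightarrow> _)"
    and A[measurable]: "A \<in> sets borel" and A_sub: "A \<subseteq> closed_triangle L"
  defines "F \<equiv> vimage_algebra (space (thinned_law g)) fst (borel :: (real ^ 'd) measure)"
  shows "AE \<omega> in thinned_law g.
      nn_cond_exp (thinned_law g) F (\<lambda>\<omega>. weighted_mass w (snd \<omega>) A) \<omega>
        = (\<integral>\<^sup>+u\<in>A. ennreal (g (fst \<omega>) u) \<partial>lborel)"
proof -
  let ?P = "thinned_law g"
  interpret P: prob_space ?P by (rule prob_space_thinned_law[OF g])
  have sub: "subalgebra ?P F"
    unfolding subalgebra_def F_def
    by (auto simp: sets_vimage_algebra2 intro: measurable_sets[OF fst_thinned_law, unfolded sets_thinned_law])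
  interpret S: sigma_finite_subalgebra ?P F
    by (intro finite_measure_subalgebra_is_sigma_finite finite_measure_subalgebra.intro
        finite_measure_subalgebra_axioms.intro sub P.finite_measure_axioms)
  have [measurable]: "(\<lambda>x. g (fst x) (snd x)) \<in> borel_measurable (borel \<Otimes>\<^sub>M borel)"
    using g by (simp add: admissible_def case_prod_beta')
  define G where "G z = (\<integral>\<^sup>+u\<in>A. ennreal (g z u) \<partial>lborel)" for z
  have G[measurable]: "G \<in> borel_measurable borel"
    unfolding G_def by measurable
  have GF: "(\<lambda>\<omega>. G (fst \<omega>)) \<in> borel_measurable F"
    unfolding F_def by (rule measurable_compose[OF measurable_vimage_algebra1 G]) auto
  have wm: "(\<lambda>\<omega>. weighted_mass w (snd \<omega>) A) \<in> borel_measurable (observation_space L)"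
    unfolding observation_space_def
    by (rule measurable_compose[OF measurable_snd measurable_weighted_mass(2)[OF w_cont A A_sub]])
  have wmP: "(\<lambda>\<omega>. weighted_mass w (snd \<omega>) A) \<in> borel_measurable ?P"
    using wm by (simp cong: measurable_cong_sets)
  have char: "(\<integral>\<^sup>+\<omega>\<in>B. weighted_mass w (snd \<omega>) A \<partial>?P) = (\<integral>\<^sup>+\<omega>\<in>B. G (fst \<omega>) \<partial>?P)"
    if B: "B \<in> sets F" for B
  proof -
    obtain S where S[measurable]: "S \<in> sets borel" and B_eq: "B = fst -` S \<inter> space ?P"
      using B unfolding F_def by (auto simp: sets_vimage_algebra2)
    let ?h = "\<lambda>x. weighted_mass w (snd (thinned_observation K x)) A * indicator S (fst (fst x))"
    have fst_th: "fst (thinned_observation K x) = fst (fst x)" for x :: "((real ^ 'd) \<times> (real \<times> real)) \<times> bool"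
      by (simp add: thinned_observation_def case_prod_beta')
    have [measurable]: "?h \<in> borel_measurable ((borel \<Otimes>\<^sub>M borel) \<Otimes>\<^sub>M count_space UNIV)"
      using measurable_compose[OF thinned_observation_measurable wm] by measurable
    have mS: "(\<lambda>\<omega>. weighted_mass w (snd \<omega>) A * indicator S (fst \<omega>)) \<in> borel_measurable (observation_space L)"
      by (intro borel_measurable_times_ennreal wm) (simp add: observation_space_def)
    have "(\<integral>\<^sup>+\<omega>\<in>B. weighted_mass w (snd \<omega>) A \<partial>?P)
        = (\<integral>\<^sup>+\<omega>. weighted_mass w (snd \<omega>) A * indicator S (fst \<omega>) \<partial>?P)"
      unfolding B_eq by (intro nn_integral_cong) (auto simp: indicator_def)
    also have "\<dots> = (\<integral>\<^sup>+x. ?h x \<partial>marked_points K (retention g))"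
      unfolding thinned_law_def
      using mS by (subst nn_integral_distr[OF thinned_observation_measurable']) (simp_all add: fst_th)
    also have "\<dots> = (\<integral>\<^sup>+z. \<integral>\<^sup>+u. ennreal (retention g z u)
         * (if u \<in> K then ennreal (w u) * indicator A u else 0) * indicator S z
         \<partial>uniform_measure lborel K \<partial>uniform_measure lborel unit_cube)"
      by (subst nn_integral_thinned_points[OF g])
         (auto intro!: nn_integral_cong simp: weighted_mass_thinned_observation[OF A A_sub] mult.assoc)
    also have "\<dots> = (\<integral>\<^sup>+z. G z * indicator S z \<partial>uniform_measure lborel unit_cube)"
    proof (rule nn_integral_cong)
      fix z :: "real ^ 'd"
      show "(\<integral>\<^sup>+u. ennreal (retention g z u)
         * (if u \<in> K then ennreal (w u) * indicator A u else 0) * indicator S z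
         \<partial>uniform_measure lborel K) = G z * indicator S z"
        using nn_integral_retention[OF g A, of z]
        by (cases "z \<in> S") (simp_all add: G_def)
    qed
    also have "\<dots> = (\<integral>\<^sup>+\<omega>. G (fst \<omega>) * indicator S (fst \<omega>) \<partial>?P)"
      by (rule nn_integral_fst_thinned_law[OF g, symmetric]) measurable
    also have "\<dots> = (\<integral>\<^sup>+\<omega>\<in>B. G (fst \<omega>) \<partial>?P)"
      unfolding B_eq by (intro nn_integral_cong) (auto simp: indicator_def)
    finally show ?thesis .
  qed
  have "AE \<omega> in ?P. G (fst \<omega>) = nn_cond_exp ?P F (\<lambda>\<omega>. weighted_mass w (snd \<omega>) A) \<omega>"
    by (rule S.nn_cond_exp_charact[OF char wmP GF])
  then show ?thesis by eventually_elim (simp add: G_def)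
qed

lemma thinned_law_in_model_class:
  assumes g: "admissible (g :: real ^ 'd \<Rightarrow> _)" and "g \<in> holder_class L s LH"
  shows "is_holder_mean_density L w s LH (thinned_law g) g"
    and "thinned_law g \<in> model_class L w s LH Mw"
proof -
  show dens: "is_holder_mean_density L w s LH (thinned_law g) g"
    unfolding is_holder_mean_density_def
    using assms nn_cond_exp_thinned_law[OF g] by (auto simp: admissible_def)
  have wm: "(\<lambda>\<omega>. weighted_mass w (snd \<omega>) (closed_triangle L)) \<in> borel_measurable (observation_space L)"
    unfolding observation_space_def
    by (rule measurable_compose[OF measurable_snd measurable_weighted_mass(2)[OF w_cont]]) auto
  have "AE \<omega> in thinned_law g. weighted_mass w (snd \<omega>) (closed_triangle L) \<le> ennreal Mw"
    unfolding thinned_law_def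
  proof (subst AE_distr_iff[OF thinned_observation_measurable'])
    show "{\<omega> \<in> space (observation_space L). weighted_mass w (snd \<omega>) (closed_triangle L) \<le> ennreal Mw}
        \<in> sets (observation_space L)"
      using wm by measurable
    show "AE x in marked_points K (retention g).
        weighted_mass w (snd (thinned_observation K x)) (closed_triangle L) \<le> ennreal Mw"
    proof (rule AE_I2)
      fix x :: "((real ^ 'd) \<times> (real \<times> real)) \<times> bool"
      obtain z u b where "x = ((z, u), b)" by (metis surj_pair)
      then show "weighted_mass w (snd (thinned_observation K x)) (closed_triangle L) \<le> ennreal Mw"
        by (auto simp: weighted_mass_thinned_observation indicator_def intro!: ennreal_leI w_le)
    qed
  qed
  then show "thinned_law g \<in> model_class L w s LH Mw"
    unfolding model_class_def
    using prob_space_thinned_law[OF g] distr_fst_thinned_law[OF g] dens by auto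
qed

end

section \<open>The mean density is determined by the law\<close>

text \<open>
  Subadditivity of \<open>t \<mapsto> t powr s\<close>: composing with it turns Lipschitz functions into \<open>s\<close>-Hoelder
  functions with the same constant.
\<close>

lemma powr_diff_le_powr:
  fixes x y s :: real
  assumes "0 \<le> x" "0 \<le> y" "0 < s" "s \<le> 1"
  shows "\<bar>x powr s - y powr s\<bar> \<le> \<bar>x - y\<bar> powr s"
proof -
  have *: "(y + t) powr s \<le> y powr s + t powr s" if "0 \<le> y" "0 \<le> t" for y t :: real
  proof (cases "y + t = 0")
    case False
    then have S: "0 < y + t" using that by simp
    have le: "a / (y + t) \<le> (a / (y + t)) powr s" if "0 \<le> a" "a \<le> y + t" for a
      using powr_mono'[of s 1 "a / (y + t)"] that S assms by simp
    have "1 = y / (y + t) + t / (y + t)" using S by (simp add: add_divide_distrib[symmetric])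
    also have "\<dots> \<le> (y / (y + t)) powr s + (t / (y + t)) powr s"
      by (intro add_mono le) (use that in auto)
    also have "\<dots> = (y powr s + t powr s) / (y + t) powr s"
      using that S by (simp add: powr_divide add_divide_distrib)
    finally show ?thesis using S by (simp add: field_simps)
  qed (use that in auto)
  have le: "a powr s - b powr s \<le> (a - b) powr s" "b powr s \<le> a powr s"
    if "0 \<le> b" "b \<le> a" for a b :: real
    using *[of b "a - b"] that powr_mono2[of s b a] assms by auto
  show ?thesis
    using le[of x y] le[of y x] assms by (cases "x \<le> y") (auto simp: abs_if)
qed

text \<open>
  Two densities that differ at an interior point differ, by continuity, with a definite gap on a
  neighbourhood \<open>S \<times> A\<close>. Then their integrals over \<open>A\<close> differ for every covariate in \<open>S\<close>, a set of
  positive probability, although both are versions of one conditional expectation.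
\<close>

lemma holder_mean_density_le:
  fixes g1 g2 :: "real ^ 'd \<Rightarrow> real \<times> real \<Rightarrow> real"
  assumes s: "0 < s" and LH: "0 < LH"
    and P: "distr P borel fst = uniform_measure lborel unit_cube" "fst \<in> measurable P borel"
    and g1: "is_holder_mean_density L w s LH P g1"
    and g2: "is_holder_mean_density L w s LH P g2"
    and z: "z \<in> unit_cube" and u: "u \<in> interior (closed_triangle L)"
  shows "g1 z u \<le> g2 z u"
proof (rule ccontr)
  assume neg: "\<not> g1 z u \<le> g2 z u"
  define \<epsilon> where "\<epsilon> = (g1 z u - g2 z u) / 4"
  have \<epsilon>: "0 < \<epsilon>" using neg by (simp add: \<epsilon>_def)
  \<comment> \<open>Within distance \<open>r\<close> in each argument both densities vary by at most \<open>\<epsilon>\<close>, a quarter of the gap.\<close>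
  define r where "r = (\<epsilon> / LH) powr (1 / s) / 2"
  have r: "0 < r" using \<epsilon> LH by (simp add: r_def)
  have r_eq: "LH * (2 * r) powr s = \<epsilon>"
    using \<epsilon> LH s by (simp add: r_def powr_powr)
  obtain r' where r': "0 < r'" "r' \<le> r" "ball u r' \<subseteq> closed_triangle L"
  proof -
    obtain e where "0 < e" "ball u e \<subseteq> closed_triangle L" using u mem_interior by blast
    moreover have "ball u (min e r) \<subseteq> ball u e" by (simp add: subset_ball)
    ultimately show ?thesis using that[of "min e r"] r by auto
  qed
  define A where "A = ball u r'"
  define S where "S = unit_cube \<inter> ball z r"
  have A: "A \<in> sets borel" "A \<subseteq> closed_triangle L" using r' by (auto simp: A_def)
  have eA: "emeasure lborel A = ennreal (measure lborel A)" "0 < measure lborel A"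
    using r'(1) emeasure_lborel_ball_finite[of u r']
    by (auto simp: A_def emeasure_eq_ennreal_measure)
  have near: "\<bar>g z' u' - g z u\<bar> \<le> \<epsilon>"
    if "g \<in> holder_class L s LH" "z' \<in> S" "u' \<in> A" for g z' u'
  proof -
    have "u \<in> closed_triangle L" using u interior_subset by blast
    then have "\<bar>g z' u' - g z u\<bar> \<le> LH * (norm (z' - z) + norm (u' - u)) powr s"
      using that z A by (auto simp: holder_class_def S_def)
    also have "\<dots> \<le> LH * (2 * r) powr s"
      using LH s that r'(2)
      by (intro mult_left_mono powr_mono2) (auto simp: S_def A_def dist_norm norm_minus_commute)
    finally show ?thesis by (simp add: r_eq)
  qed
  have g2_nn: "0 \<le> g2 z u" using g2 z u interior_subset
    by (auto simp: is_holder_mean_density_def)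
  have neq: "(\<integral>\<^sup>+v\<in>A. ennreal (g1 z' v) \<partial>lborel) \<noteq> (\<integral>\<^sup>+v\<in>A. ennreal (g2 z' v) \<partial>lborel)"
    if z': "z' \<in> S" for z'
  proof -
    have "(\<integral>\<^sup>+v\<in>A. ennreal (g2 z' v) \<partial>lborel) \<le> (\<integral>\<^sup>+v. ennreal (g2 z u + \<epsilon>) * indicator A v \<partial>lborel)"
      using near[OF _ z'] g2
      by (intro nn_integral_mono) (force simp: indicator_def is_holder_mean_density_def intro!: ennreal_leI)
    also have "\<dots> = ennreal ((g2 z u + \<epsilon>) * measure lborel A)"
      using A g2_nn \<epsilon> by (simp add: nn_integral_cmult_indicator eA ennreal_mult')
    also have "\<dots> < ennreal ((g2 z u + 2 * \<epsilon>) * measure lborel A)"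
      using eA g2_nn \<epsilon> by (intro ennreal_lessI mult_strict_right_mono) auto
    also have "\<dots> = (\<integral>\<^sup>+v. ennreal (g2 z u + 2 * \<epsilon>) * indicator A v \<partial>lborel)"
      using A g2_nn \<epsilon> by (simp add: nn_integral_cmult_indicator eA ennreal_mult')
    also have "\<dots> \<le> (\<integral>\<^sup>+v\<in>A. ennreal (g1 z' v) \<partial>lborel)"
    proof (intro nn_integral_mono)
      fix v
      have "g1 z u = g2 z u + 4 * \<epsilon>" by (simp add: \<epsilon>_def field_simps)
      moreover have "g1 \<in> holder_class L s LH" using g1 by (simp add: is_holder_mean_density_def)
      ultimately have "v \<in> A \<Longrightarrow> g2 z u + 2 * \<epsilon> \<le> g1 z' v"
        using near[OF _ z', of g1 v] \<epsilon> by fastforce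
      then show "ennreal (g2 z u + 2 * \<epsilon>) * indicator A v \<le> ennreal (g1 z' v) * indicator A v"
        by (auto simp: indicator_def intro!: ennreal_leI)
    qed
    finally show ?thesis by simp
  qed
  have cond: "AE \<omega> in P. nn_cond_exp P (vimage_algebra (space P) fst borel)
        (\<lambda>\<omega>'. weighted_mass w (snd \<omega>') A) \<omega> = (\<integral>\<^sup>+v\<in>A. ennreal (g (fst \<omega>) v) \<partial>lborel)"
    if "is_holder_mean_density L w s LH P g" for g
    using that A unfolding is_holder_mean_density_def by blast
  have "AE \<omega> in P. fst \<omega> \<notin> S"
    using cond[OF g1] cond[OF g2]
  proof eventually_elim
    case (elim \<omega>)
    then show ?case using neq[of "fst \<omega>"] by argo
  qed
  moreover have S: "S \<in> sets borel" by (simp add: S_def)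
  ultimately have "AE x in distr P borel fst. x \<notin> S"
    by (subst AE_distr_iff[OF P(2)]) auto
  then have "emeasure (uniform_measure lborel unit_cube) S = 0"
    unfolding P(1) using S by (subst (asm) AE_iff_measurable[OF _ refl]) auto
  then have null: "emeasure lborel S = 0"
    using S by (simp add: emeasure_unit_cube S_def)
  \<comment> \<open>\<open>z\<close> may lie on the boundary of the cube, but then interior points of the cube are close to it.\<close>
  have ne: "box 0 (1 :: real ^ 'd) \<noteq> {}"
    by (auto simp: box_ne_empty Basis_vec_def inner_axis)
  have "z \<in> closure (box 0 1)" using z ne by (simp add: unit_cube_eq_cbox)
  then have "ball z r \<inter> box 0 1 \<noteq> {}"
    using r by (force simp: closure_approachable dist_commute)
  moreover have "ball z r \<inter> box 0 1 \<subseteq> S"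
    using box_subset_cbox by (auto simp: S_def unit_cube_eq_cbox)
  then have "emeasure lborel (ball z r \<inter> box 0 1) = 0"
    using null S by (metis emeasure_mono le_zero_eq sets_lborel)
  then have "negligible (ball z r \<inter> box 0 1)"
    by (intro negligible_iff_null_sets[THEN iffD2] null_sets_completionI) auto
  ultimately show False using open_not_negligible[of "ball z r \<inter> box 0 1"] by auto
qed

text \<open>
  Comparisons with the estimand thus reduce to comparisons with the density that was put into the
  construction, at least at interior points, and one such point suffices for the lower bound.
\<close>

lemma mean_density_eq:
  fixes g :: "real ^ 'd \<Rightarrow> real \<times> real \<Rightarrow> real"
  assumes "0 < s" "0 < LH"
    and "distr P borel fst = uniform_measure lborel unit_cube" "fst \<in> measurable P borel"
    and g: "is_holder_mean_density L w s LH P g"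
    and "z \<in> unit_cube" "u \<in> interior (closed_triangle L)"
  shows "mean_density L w s LH P z u = g z u"
proof -
  have "is_holder_mean_density L w s LH P (mean_density L w s LH P)"
    unfolding mean_density_def using someI[of "is_holder_mean_density L w s LH P", OF g] .
  then show ?thesis
    using holder_mean_density_le[OF assms(1-4) _ _ assms(6,7)] g by (intro antisym) blast+
qed

lemma sup_dist_ge:
  assumes "z \<in> unit_cube" "u \<in> closed_triangle L"
  shows "ennreal \<bar>f z u - g z u\<bar> \<le> sup_dist L f g"
  unfolding sup_dist_def by (rule SUP_upper2[OF assms(1)], rule SUP_upper[OF assms(2)])

section \<open>Local Hoelder bumps and their likelihood ratios\<close>

text \<open>
  The constant \<open>A\<close> is small for two reasons: a sum of two \<open>s\<close>-Hoelder functions with constant \<open>A\<close>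
  must have constant at most \<open>LH\<close>, and all retention probabilities must be at most \<open>1/2\<close>, so that the
  probability of an empty diagram is bounded away from \<open>0\<close> as well.
\<close>

locale bump_model =
  fixes L Mw :: real and w :: "real \<times> real \<Rightarrow> real"
    and u0 :: "real \<times> real" and R w0 s LH A :: real
  assumes w_cont: "continuous_on (closed_triangle L) w"
    and R: "0 < R" and ball_sub: "ball u0 R \<subseteq> open_triangle L"
    and w_ge: "\<And>u. u \<in> ball u0 R \<Longrightarrow> w0 \<le> w u" and w_le: "\<And>u. u \<in> ball u0 R \<Longrightarrow> w u \<le> Mw"
    and w0: "0 < w0" and s: "0 < s" "s \<le> 1"
    and A: "0 < A" "2 * A \<le> LH" "4 * (measure lborel (ball u0 R) * (A * R powr s)) \<le> w0"
begin

sublocale thinned_point_model L Mw w "ball u0 R"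
  using w_cont R ball_sub w_ge w_le w0 by unfold_locales force+

abbreviation "area \<equiv> measure lborel (ball u0 R)"

text \<open>
  Both profiles are \<open>A\<close> times the \<open>s\<close>-th power of the positive part of a \<open>1\<close>-Lipschitz function. The
  null density \<open>base\<close> does not depend on the covariate and is bounded below on the concentric ball of
  radius \<open>R / 2\<close>, which contains the points of all bumps with \<open>2 * h \<le> R\<close>; a bump of radius \<open>h\<close> has height \<open>A * h powr s\<close>, the largest order that the
  Hoelder condition permits.
\<close>

definition base :: "real \<times> real \<Rightarrow> real" where
  "base u = A * max 0 (R - norm (u - u0)) powr s"

definition bump :: "real \<Rightarrow> real ^ 'd \<Rightarrow> real ^ 'd \<Rightarrow> real \<times> real \<Rightarrow> real" where
  "bump h c z u = A * max 0 (h - (norm (z - c) + norm (u - u0))) powr s"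

definition hypothesis :: "real \<Rightarrow> real ^ 'd \<Rightarrow> real ^ 'd \<Rightarrow> real \<times> real \<Rightarrow> real" where
  "hypothesis h c z u = base u + bump h c z u"

lemma hypothesis_zero: "hypothesis 0 c z u = base u"
proof -
  have "max 0 (0 - (norm (z - c) + norm (u - u0))) = 0"
    using norm_ge_zero[of "z - c"] norm_ge_zero[of "u - u0"] by linarith
  then show ?thesis unfolding hypothesis_def bump_def by simp
qed

lemma base_bounds: "0 \<le> base u" "base u \<le> A * R powr s" "u \<in> ball u0 R \<Longrightarrow> 0 < base u"
  "u \<notin> ball u0 R \<Longrightarrow> base u = 0"
  unfolding base_def using A R s
  by (auto intro!: mult_left_mono powr_mono2 simp: dist_norm norm_minus_commute)

lemma bump_bounds:
  assumes "0 \<le> h"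
  shows "0 \<le> bump h c z u" "bump h c z u \<le> A * h powr s"
    "h \<le> norm (z - c) + norm (u - u0) \<Longrightarrow> bump h c z u = 0"
proof -
  have "0 \<le> norm (z - c) + norm (u - u0)" by simp
  then have "max 0 (h - (norm (z - c) + norm (u - u0))) \<le> h" using assms by linarith
  then show "bump h c z u \<le> A * h powr s"
    unfolding bump_def using A s by (intro mult_left_mono powr_mono2) auto
  show "0 \<le> bump h c z u" unfolding bump_def using A by simp
  show "bump h c z u = 0" if "h \<le> norm (z - c) + norm (u - u0)"
    using that by (simp add: bump_def max_def)
qed

lemma hypothesis_peak: "0 \<le> h \<Longrightarrow> hypothesis h c c u0 = A * R powr s + A * h powr s"
  using R by (simp add: hypothesis_def base_def bump_def)

lemma hypothesis_holder: "hypothesis h (c :: real ^ 'd) \<in> holder_class L s LH"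
proof -
  have lip: "\<bar>A * max 0 a powr s - A * max 0 b powr s\<bar> \<le> A * d powr s" if "\<bar>a - b\<bar> \<le> d" for a b d
  proof -
    have "\<bar>A * max 0 a powr s - A * max 0 b powr s\<bar> = A * \<bar>max 0 a powr s - max 0 b powr s\<bar>"
      using A by (simp add: right_diff_distrib[symmetric] abs_mult)
    also have "\<dots> \<le> A * \<bar>max 0 a - max 0 b\<bar> powr s"
      using A s by (intro mult_left_mono powr_diff_le_powr) auto
    also have "\<dots> \<le> A * d powr s"
      using A s that by (intro mult_left_mono powr_mono2) auto
    finally show ?thesis .
  qed
  have "\<bar>hypothesis h c z u - hypothesis h c z' u'\<bar> \<le> LH * (norm (z - z') + norm (u - u')) powr s"
    for z z' :: "real ^ 'd" and u u' :: "real \<times> real"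
  proof -
    let ?d = "norm (z - z') + norm (u - u')"
    have t: "\<bar>norm (u - u0) - norm (u' - u0)\<bar> \<le> norm (u - u')"
      "\<bar>norm (z - c) - norm (z' - c)\<bar> \<le> norm (z - z')"
      using norm_triangle_ineq3[of "u - u0" "u' - u0"] norm_triangle_ineq3[of "z - c" "z' - c"] by auto
    have "\<bar>base u - base u'\<bar> \<le> A * ?d powr s"
      unfolding base_def using t norm_ge_zero[of "z - z'"] by (intro lip) linarith
    moreover have "\<bar>bump h c z u - bump h c z' u'\<bar> \<le> A * ?d powr s"
      unfolding bump_def using t by (intro lip) linarith
    ultimately have "\<bar>hypothesis h c z u - hypothesis h c z' u'\<bar> \<le> 2 * A * ?d powr s"
      unfolding hypothesis_def by linarith
    also have "\<dots> \<le> LH * ?d powr s" using A by (intro mult_right_mono) auto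
    finally show ?thesis .
  qed
  then show ?thesis by (simp add: holder_class_def)
qed

lemma base_measurable [measurable]: "base \<in> borel_measurable borel"
  unfolding base_def by measurable

lemma bump_measurable [measurable]:
  "(\<lambda>x. bump h c (fst x) (snd x)) \<in> borel_measurable (borel \<Otimes>\<^sub>M borel)"
  unfolding bump_def by measurable

lemma hypothesis_admissible:
  fixes c :: "real ^ 'd"
  assumes h: "0 \<le> h" "h \<le> R"
  shows "admissible (hypothesis h c)"
  unfolding admissible_def
proof (intro conjI allI impI)
  show "case_prod (hypothesis h c) \<in> borel_measurable (borel \<Otimes>\<^sub>M borel)"
    unfolding case_prod_beta' hypothesis_def by measurable
  fix z :: "real ^ 'd" and u
  show "0 \<le> hypothesis h c z u"
    unfolding hypothesis_def using base_bounds(1) bump_bounds(1)[OF h(1)] by (intro add_nonneg_nonneg)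
  show "hypothesis h c z u = 0" if "u \<notin> ball u0 R"
  proof -
    have "h \<le> norm (z - c) + norm (u - u0)"
      using that h norm_ge_zero[of "z - c"]
      unfolding mem_ball dist_norm norm_minus_commute[of u0] by linarith
    then show ?thesis
      using base_bounds(4)[OF that] bump_bounds(3)[OF h(1)] by (simp add: hypothesis_def)
  qed
  show "area * hypothesis h c z u \<le> w u" if "u \<in> ball u0 R"
  proof -
    have "bump h c z u \<le> A * R powr s"
      using bump_bounds(2)[OF h(1), of c z u] A s h
      by (elim order_trans) (intro mult_left_mono powr_mono2, auto)
    then have "hypothesis h c z u \<le> 2 * (A * R powr s)"
      using base_bounds(2)[of u] by (simp add: hypothesis_def)
    then have "area * hypothesis h c z u \<le> area * (2 * (A * R powr s))"
      by (rule mult_left_mono) simp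
    also have "\<dots> \<le> w0" using A w0 by linarith
    also have "\<dots> \<le> w u" by (rule w_ge[OF that])
    finally show ?thesis .
  qed
qed

abbreviation null_points :: "(((real ^ 'd) \<times> (real \<times> real)) \<times> bool) measure" where
  "null_points \<equiv> marked_points (ball u0 R) (retention (\<lambda>z. base))"

lemma base_admissible: "admissible (\<lambda>z :: real ^ 'd. base)"
  using hypothesis_admissible[of 0 "0 :: real ^ 'd"] R
  by (simp add: hypothesis_zero[abs_def] fun_eq_iff cong: arg_cong[of _ _ admissible])

lemma retention_base_le: "retention (\<lambda>z. base) z u \<le> 1/2"
proof (cases "u \<in> ball u0 R")
  case True
  have "area * base u \<le> area * (A * R powr s)"
    by (intro mult_left_mono base_bounds) simp
  also have "\<dots> \<le> w u / 2" using A w0 w_ge[OF True] by linarith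
  finally show ?thesis using True w_pos[OF True] by (simp add: retention_def field_simps)
qed (simp add: retention_def)

text \<open>
  The likelihood ratio of a bump hypothesis against the null, minus \<open>1\<close>. For a kept point the
  retention factors cancel and leave the relative size of the bump. For a discarded point the
  retention probability has grown by \<open>retention (bump h c)\<close>. Where \<open>base\<close> vanishes the quotient is
  \<open>0\<close> by the convention for division, and there the null has no kept points.
\<close>

definition excess :: "real \<Rightarrow> real ^ 'd \<Rightarrow> ((real ^ 'd) \<times> (real \<times> real)) \<times> bool \<Rightarrow> real" where
  "excess h c = (\<lambda>((z, u), b). if b then bump h c z u / base u
     else - retention (bump h c) z u / (1 - retention (\<lambda>z. base) z u))"

lemma bump_admissible:
  fixes c :: "real ^ 'd"
  assumes "0 \<le> h" "h \<le> R"
  shows "admissible (bump h c)"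
proof -
  have "bump h c z u \<le> hypothesis h c z u" for z u
    using base_bounds(1) by (simp add: hypothesis_def)
  then have "area * bump h c z u \<le> area * hypothesis h c z u" for z u
    by (intro mult_left_mono) auto
  moreover have "u \<notin> ball u0 R \<Longrightarrow> bump h c z u = 0" for z u
    using admissibleD(2)[OF hypothesis_admissible[OF assms], of u c z] base_bounds(4)[of u]
    by (simp add: hypothesis_def)
  moreover have "u \<in> ball u0 R \<Longrightarrow> area * hypothesis h c z u \<le> w u" for z u
    by (rule admissibleD(3)[OF hypothesis_admissible[OF assms]])
  ultimately show ?thesis
    using bump_bounds(1)[OF assms(1)]
    unfolding admissible_def case_prod_beta' by (blast intro: order_trans bump_measurable)
qed

lemma excess_measurable:
  fixes c :: "real ^ 'd"
  assumes "0 \<le> h" "h \<le> R"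
  shows "excess h c \<in> borel_measurable ((borel \<Otimes>\<^sub>M borel) \<Otimes>\<^sub>M count_space UNIV)"
proof -
  have [measurable]:
    "(\<lambda>x. retention (bump h c) (fst x) (snd x)) \<in> borel_measurable (borel \<Otimes>\<^sub>M borel)"
    "(\<lambda>x. retention (\<lambda>z. base) (fst x) (snd x)) \<in> borel_measurable (borel \<Otimes>\<^sub>M borel)"
    using retention_measurable[OF bump_admissible[OF assms], of c]
      retention_measurable[OF base_admissible] by (simp_all add: case_prod_beta')
  show ?thesis unfolding excess_def case_prod_beta' by measurable
qed

lemma excess_bound:
  fixes c :: "real ^ 'd"
  assumes h: "0 < h" "2 * h \<le> R"
  shows "\<bar>excess h c ((z, u), b)\<bar> \<le>
    (if norm (z - c) < h \<and> norm (u - u0) < h then (2 * h / R) powr s else 0)"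
proof (cases "norm (z - c) < h \<and> norm (u - u0) < h")
  case False
  then have "h \<le> norm (z - c) + norm (u - u0)"
    using norm_ge_zero[of "z - c"] norm_ge_zero[of "u - u0"] by linarith
  then have "bump h c z u = 0" by (rule bump_bounds(3)[OF less_imp_le[OF h(1)]])
  then have "excess h c ((z, u), b) = 0" by (simp add: excess_def retention_def)
  then show ?thesis by simp
next
  case True
  then have u: "u \<in> ball u0 R" using h by (simp add: dist_norm norm_minus_commute)
  have "A * (R / 2) powr s \<le> base u"
    unfolding base_def using True h A s R by (intro mult_left_mono powr_mono2) auto
  then have "bump h c z u / base u \<le> (A * h powr s) / (A * (R / 2) powr s)"
    using bump_bounds(1,2)[OF less_imp_le[OF h(1)], of c z u] R A by (intro frac_le) auto
  also have "\<dots> = (2 * h / R) powr s"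
    using A h R by (simp add: powr_divide powr_mult field_simps)
  finally have t: "bump h c z u / base u \<le> (2 * h / R) powr s" .
  have "retention (bump h c) z u \<le> (area * (A * h powr s)) / w0"
    unfolding retention_def if_P[OF u]
    using bump_bounds(1,2)[OF less_imp_le[OF h(1)], of c z u] w_ge[OF u] w0 A
    by (intro frac_le mult_left_mono mult_nonneg_nonneg) auto
  also have "\<dots> = (area * (A * R powr s)) / w0 * (h / R) powr s"
    using h R by (simp add: powr_divide)
  also have "\<dots> \<le> 1/4 * (h / R) powr s"
    using A w0 by (intro mult_right_mono) (auto simp: field_simps)
  finally have r: "retention (bump h c) z u \<le> 1/4 * (h / R) powr s" .
  have r0: "0 \<le> retention (bump h c) z u"
    using retention_bounds(1)[OF bump_admissible, of h c z u] h by simp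
  have "retention (bump h c) z u / (1 - retention (\<lambda>z. base) z u)
      \<le> (1/4 * (h / R) powr s) / (1/2)"
    using r r0 retention_base_le[of z u] by (intro frac_le) auto
  also have "\<dots> \<le> (h / R) powr s" by simp
  also have "\<dots> \<le> (2 * h / R) powr s" using h R s by (intro powr_mono2) (auto simp: field_simps)
  finally have f: "retention (bump h c) z u / (1 - retention (\<lambda>z. base) z u) \<le> (2 * h / R) powr s" .
  have "0 \<le> bump h c z u / base u" "0 \<le> retention (bump h c) z u / (1 - retention (\<lambda>z. base) z u)"
    using bump_bounds(1)[of h c z u] base_bounds(1)[of u] r0 retention_base_le[of z u] h by auto
  then have "\<bar>bump h c z u / base u\<bar> \<le> (2 * h / R) powr s"
    "\<bar>- retention (bump h c) z u / (1 - retention (\<lambda>z. base) z u)\<bar> \<le> (2 * h / R) powr s"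
    using t f unfolding minus_divide_left[symmetric] abs_minus_cancel by linarith+
  then show ?thesis using True unfolding excess_def by simp
qed

lemma excess_le_one:
  fixes c :: "real ^ 'd"
  assumes h: "0 < h" "2 * h \<le> R"
  shows "\<bar>excess h c x\<bar> \<le> 1"
proof -
  obtain z u b where x: "x = ((z, u), b)" by (metis surj_pair)
  have "(2 * h / R) powr s \<le> 1" using h R s by (intro powr_le1) auto
  then show ?thesis unfolding x using excess_bound[OF h, of c z u b] by (auto split: if_splits)
qed

lemma marked_points_hypothesis:
  fixes c :: "real ^ 'd"
  assumes h: "0 < h" "2 * h \<le> R"
  shows "marked_points (ball u0 R) (retention (hypothesis h c))
    = density null_points (\<lambda>x. ennreal (1 + excess h c x))"
proof -
  let ?N = "(uniform_measure lborel unit_cube \<Otimes>\<^sub>M uniform_measure lborel (ball u0 R))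
    \<Otimes>\<^sub>M count_space UNIV :: (((real ^ 'd) \<times> (real \<times> real)) \<times> bool) measure"
  let ?f = "\<lambda>((z :: real ^ 'd, u), b). ennreal (if b then retention (\<lambda>z. base) z u else 1 - retention (\<lambda>z. base) z u)"
  have sN: "sets ?N = sets ((borel \<Otimes>\<^sub>M borel) \<Otimes>\<^sub>M count_space UNIV)"
    by (intro sets_pair_measure_cong) auto
  have [measurable]:
    "(\<lambda>x. retention (\<lambda>z. base) (fst x) (snd x)) \<in> borel_measurable ((borel :: (real ^ 'd) measure) \<Otimes>\<^sub>M borel)"
    using retention_measurable[OF base_admissible] by (simp_all add: case_prod_beta')
  have "?f \<in> borel_measurable ((borel \<Otimes>\<^sub>M borel) \<Otimes>\<^sub>M count_space UNIV)"
    unfolding case_prod_beta' by measurable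
  then have f: "?f \<in> borel_measurable ?N" by (subst measurable_cong_sets[OF sN refl])
  have "(\<lambda>x. ennreal (1 + excess h c x)) \<in> borel_measurable ((borel \<Otimes>\<^sub>M borel) \<Otimes>\<^sub>M count_space UNIV)"
    using excess_measurable[of h c] h by simp
  then have e: "(\<lambda>x. ennreal (1 + excess h c x)) \<in> borel_measurable ?N"
    by (subst measurable_cong_sets[OF sN refl])
  have "?f ((z, u), b) * ennreal (1 + excess h c ((z, u), b))
      = ennreal (if b then retention (hypothesis h c) z u else 1 - retention (hypothesis h c) z u)"
    for z u b
  proof -
    let ?p = "retention (\<lambda>z. base) z u"
    have p: "0 \<le> ?p" "?p \<le> 1/2" by (rule retention_bounds(1)[OF base_admissible], rule retention_base_le)
    have split: "retention (hypothesis h c) z u = ?p + retention (bump h c) z u"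
      by (simp add: retention_def hypothesis_def ring_distribs add_divide_distrib)
    have "(if b then ?p else 1 - ?p) * (1 + excess h c ((z, u), b))
       = (if b then retention (hypothesis h c) z u else 1 - retention (hypothesis h c) z u)"
    proof (cases b)
      case True
      have "?p * (1 + bump h c z u / base u) = ?p + retention (bump h c) z u"
        using base_bounds(3)[of u] w_pos[of u]
        by (cases "u \<in> ball u0 R") (auto simp: retention_def divide_simps ring_distribs)
      then show ?thesis using True split by (simp add: excess_def)
    next
      case False
      have "(1 - ?p) * (1 + - retention (bump h c) z u / (1 - ?p)) = 1 - ?p - retention (bump h c) z u"
        using p by (simp add: field_simps)
      then show ?thesis using False split by (simp add: excess_def)
    qed
    moreover have "0 \<le> 1 + excess h c ((z, u), b)"
      using excess_le_one[OF h, of c "((z, u), b)"] by (simp add: abs_le_iff)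
    ultimately show ?thesis using p by (simp add: ennreal_mult''[symmetric])
  qed
  then have "(\<lambda>x. ?f x * ennreal (1 + excess h c x))
    = (\<lambda>((z, u), b). ennreal (if b then retention (hypothesis h c) z u else 1 - retention (hypothesis h c) z u))"
    unfolding fun_eq_iff split_paired_All by simp
  then show ?thesis
    unfolding marked_points_def by (subst density_density_eq[OF f e]) simp
qed

definition variance_const :: "'d itself \<Rightarrow> real" where
  "variance_const _ = (2 / R) powr (2 * s) * unit_ball_vol CARD('d) * unit_ball_vol 2 / area"

lemma variance_const_pos: "0 < variance_const TYPE('d)"
  using K_measure(2) R by (simp add: variance_const_def)

text \<open>
  The excess is of order \<open>h powr s\<close> on a set \<open>ball c h \<times> ball u0 h\<close> in dimension \<open>CARD('d) + 2\<close>, and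
  covariate and point have bounded densities under the null. This is the origin of the exponent.
\<close>

lemma excess_second_moment:
  fixes c :: "real ^ 'd"
  assumes h: "0 < h" "2 * h \<le> R"
  shows "(\<integral>x. (excess h c x)\<^sup>2 \<partial>null_points)
    \<le> variance_const TYPE('d) * h powr (2 * s + real CARD('d) + 2)"
    (is "_ \<le> ?C * _")
proof -
  interpret N: prob_space "null_points :: (((real ^ 'd) \<times> (real \<times> real)) \<times> bool) measure"
    by (rule prob_space_thinned_points[OF base_admissible])
  let ?b = "(2 * h / R) powr s"
  let ?S = "ball c h \<times> ball u0 h"
  have em: "excess h c \<in> borel_measurable null_points"
    using excess_measurable[of h c] h by (simp cong: measurable_cong_sets add: sets_marked_points)
  have bd: "(excess h c x)\<^sup>2 \<le> ?b\<^sup>2 * indicator ?S (fst x)" for x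
  proof -
    obtain z u b where x: "x = ((z, u), b)" by (metis surj_pair)
    have "\<bar>excess h c x\<bar> \<le> ?b * indicator ?S (fst x)"
      using excess_bound[OF h, of c z u b]
      by (auto simp: x indicator_def dist_norm norm_minus_commute)
    then have "(excess h c x)\<^sup>2 \<le> (?b * indicator ?S (fst x))\<^sup>2"
      by (metis abs_ge_zero power2_abs power_mono)
    then show ?thesis by (auto simp: power_mult_distrib indicator_def split: if_splits)
  qed
  have Sm[measurable]: "?S \<in> sets (borel \<Otimes>\<^sub>M borel)" by simp
  have "(\<integral>\<^sup>+x. ennreal ((excess h c x)\<^sup>2) \<partial>null_points)
      \<le> (\<integral>\<^sup>+x. ennreal (?b\<^sup>2) * indicator ?S (fst x) \<partial>null_points)"
  proof (rule nn_integral_mono)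
    fix x
    show "ennreal ((excess h c x)\<^sup>2) \<le> ennreal (?b\<^sup>2) * indicator ?S (fst x)"
      using ennreal_leI[OF bd[of x]] by (cases "fst x \<in> ?S") (simp_all del: mem_Times_iff)
  qed
  also have "\<dots> = (\<integral>\<^sup>+z. \<integral>\<^sup>+u. ennreal (?b\<^sup>2) * indicator ?S (z, u)
      \<partial>uniform_measure lborel (ball u0 R) \<partial>uniform_measure lborel unit_cube)"
    by (rule nn_integral_thinned_points_unmarked[OF base_admissible]) measurable
  also have "\<dots> = (\<integral>\<^sup>+z. \<integral>\<^sup>+u. ennreal (?b\<^sup>2) * indicator (ball c h) z * indicator (ball u0 h) u
      \<partial>uniform_measure lborel (ball u0 R) \<partial>uniform_measure lborel unit_cube)"
    by (simp add: indicator_times mult.assoc)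
  also have "\<dots> = ennreal (?b\<^sup>2) * emeasure (uniform_measure lborel unit_cube) (ball c h)
      * emeasure (uniform_measure lborel (ball u0 R)) (ball u0 h)"
  proof -
    have [measurable]: "ball u0 h \<in> sets (uniform_measure lborel (ball u0 R))"
      "ball c h \<in> sets (uniform_measure lborel (unit_cube :: (real ^ 'd) set))" by simp_all
    show ?thesis
      by (simp add: nn_integral_cmult nn_integral_multc nn_integral_cmult_indicator
          mult.assoc del: emeasure_uniform_measure)
  qed
  also have "\<dots> \<le> ennreal (?b\<^sup>2) * ennreal (unit_ball_vol CARD('d) * h ^ CARD('d))
      * ennreal (unit_ball_vol 2 * h\<^sup>2 / area)"
  proof (intro mult_mono)
    have "emeasure (uniform_measure lborel unit_cube) (ball c h) \<le> emeasure lborel (ball c h)"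
      by (simp add: emeasure_unit_cube emeasure_mono divide_ennreal_def)
    then show "emeasure (uniform_measure lborel unit_cube) (ball c h)
        \<le> ennreal (unit_ball_vol CARD('d) * h ^ CARD('d))"
      using h by (simp add: emeasure_ball)
    have "emeasure (uniform_measure lborel (ball u0 R)) (ball u0 h)
        \<le> emeasure lborel (ball u0 h) / emeasure lborel (ball u0 R)"
      by (simp add: emeasure_mono divide_right_mono_ennreal)
    also have "\<dots> = ennreal (unit_ball_vol 2 * h\<^sup>2) / ennreal area"
      unfolding K_measure(1) using h by (simp add: emeasure_ball power2_eq_square)
    also have "\<dots> = ennreal (unit_ball_vol 2 * h\<^sup>2 / area)"
      using K_measure(2) by (intro divide_ennreal) auto
    finally show "emeasure (uniform_measure lborel (ball u0 R)) (ball u0 h)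
        \<le> ennreal (unit_ball_vol 2 * h\<^sup>2 / area)" .
  qed auto
  also have "\<dots> = ennreal (?b\<^sup>2 * (unit_ball_vol CARD('d) * h ^ CARD('d)) * (unit_ball_vol 2 * h\<^sup>2 / area))"
    using h by (subst ennreal_mult'[symmetric], simp, subst ennreal_mult'[symmetric]) auto
  also have "?b\<^sup>2 * (unit_ball_vol CARD('d) * h ^ CARD('d)) * (unit_ball_vol 2 * h\<^sup>2 / area)
     = ?C * h powr (2 * s + real CARD('d) + 2)"
  proof -
    have "?b\<^sup>2 = (2 / R) powr (2 * s) * h powr (2 * s)"
      using h R by (simp add: powr_mult[symmetric] powr_power mult.commute[of s])
    moreover have "h ^ CARD('d) = h powr real CARD('d)" "h\<^sup>2 = h powr 2"
      using h by (simp_all add: powr_realpow)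
    ultimately show ?thesis
      by (simp add: variance_const_def powr_add)
  qed
  finally have "(\<integral>\<^sup>+x. ennreal ((excess h c x)\<^sup>2) \<partial>null_points)
      \<le> ennreal (?C * h powr (2 * s + real CARD('d) + 2))" .
  moreover have "integrable null_points (\<lambda>x. (excess h c x)\<^sup>2)"
    using em
    by (intro N.integrable_const_bound[of _ 1]) (auto simp: abs_square_le_1 excess_le_one[OF h])
  then have "(\<integral>\<^sup>+x. ennreal ((excess h c x)\<^sup>2) \<partial>null_points) = ennreal (\<integral>x. (excess h c x)\<^sup>2 \<partial>null_points)"
    by (intro nn_integral_eq_integral) auto
  moreover have "0 \<le> ?C * h powr (2 * s + real CARD('d) + 2)"
    using variance_const_pos[where 'd = 'd] by simp
  ultimately show ?thesis by (metis ennreal_le_iff)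
qed

end

section \<open>The minimax lower bound\<close>

context bump_model
begin

lemma u0_in: "u0 \<in> ball u0 R" using R by simp

lemma u0_interior: "u0 \<in> interior (closed_triangle L)"
  by (rule interiorI[OF open_ball u0_in K_sub_closed])

lemma LH_pos: "0 < LH" using A by linarith

text \<open>
  The sample is the image of a sample of latent points, so events about the observations can be
  evaluated on the latent space.
\<close>

lemma sample_law_thinned_law:
  assumes "admissible (g :: real ^ 'd \<Rightarrow> _)"
  shows "sample_law n (thinned_law g) = distr
    (\<Pi>\<^sub>M i\<in>{1..n}. marked_points (ball u0 R) (retention g)) (\<Pi>\<^sub>M i\<in>{1..n}. observation_space L)
    (compose {1..n} (thinned_observation (ball u0 R)))"
proof -
  let ?N = "marked_points (ball u0 R) (retention g)"
  have "(\<Pi>\<^sub>M i\<in>{1..n}. thinned_law g)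
      = (\<Pi>\<^sub>M i\<in>{1..n}. distr ?N (thinned_law g) (thinned_observation (ball u0 R)))"
  proof -
    have "thinned_law g = distr ?N (thinned_law g) (thinned_observation (ball u0 R))"
      by (subst thinned_law_def) (intro distr_cong refl, simp)
    then show ?thesis by simp
  qed
  also have "\<dots> = distr (\<Pi>\<^sub>M i\<in>{1..n}. ?N) (\<Pi>\<^sub>M i\<in>{1..n}. thinned_law g)
      (compose {1..n} (thinned_observation (ball u0 R)))"
  proof (rule distr_PiM_finite_prob_space[symmetric])
    show "product_prob_space (\<lambda>i. ?N)" "product_prob_space (\<lambda>i. thinned_law g)"
      using prob_space_thinned_points[OF assms] prob_space_thinned_law[OF assms]
      by (auto intro: product_prob_spaceI)
    show "thinned_observation (ball u0 R) \<in> measurable ?N (thinned_law g)"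
      using thinned_observation_measurable' by (simp cong: measurable_cong_sets)
  qed simp
  also have "\<dots> = distr (\<Pi>\<^sub>M i\<in>{1..n}. ?N) (\<Pi>\<^sub>M i\<in>{1..n}. observation_space L)
      (compose {1..n} (thinned_observation (ball u0 R)))"
    by (intro distr_cong refl sets_PiM_cong) auto
  finally show ?thesis unfolding sample_law_def .
qed

text \<open>
  The exceedance event need not be measurable. Its outer probability is bounded below by the probability
  of a measurable event \<open>G\<close> on which the estimator already errs at a point above \<open>u0\<close>.
\<close>

lemma exceedance_prob_ge:
  fixes g :: "real ^ 'd \<Rightarrow> real \<times> real \<Rightarrow> real"
  assumes adm: "admissible g" and hol: "g \<in> holder_class L s LH"
    and G: "G \<in> sets (\<Pi>\<^sub>M i\<in>{1..n}. observation_space L)"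
    and far: "\<And>y. y \<in> G \<Longrightarrow> \<exists>z\<in>unit_cube. r \<le> \<bar>T y z u0 - g z u0\<bar>"
  defines "\<Phi> \<equiv> compose {1..n} (thinned_observation (ball u0 R))"
    and "N \<equiv> \<Pi>\<^sub>M i\<in>{1..n}. marked_points (ball u0 R) (retention g)"
  shows "emeasure N (\<Phi> -` G \<inter> space N) \<le> exceedance_prob L w s LH n r T (thinned_law g)"
proof -
  let ?S = "sample_law n (thinned_law g)"
  have sS: "sets ?S = sets (\<Pi>\<^sub>M i\<in>{1..n}. observation_space L)"
    unfolding sample_law_def by (intro sets_PiM_cong) auto
  have \<Phi>: "\<Phi> \<in> measurable N (\<Pi>\<^sub>M i\<in>{1..n}. observation_space L)"
    unfolding \<Phi>_def N_def compose_def
    by (intro measurable_restrict measurable_compose[OF measurable_component_singleton]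
        thinned_observation_measurable')
  have dens: "mean_density L w s LH (thinned_law g) z u0 = g z u0" if "z \<in> unit_cube" for z
    by (rule mean_density_eq[OF s(1) LH_pos distr_fst_thinned_law[OF adm] fst_thinned_law
        thinned_law_in_model_class(1)[OF adm hol] that u0_interior])
  have "G \<subseteq> {x \<in> space ?S. ennreal r \<le> sup_dist L (T x) (mean_density L w s LH (thinned_law g))}"
  proof (intro subsetI CollectI conjI)
    fix y assume y: "y \<in> G"
    show "y \<in> space ?S" using y G sets.sets_into_space[of G ?S] sS by auto
    obtain z where z: "z \<in> unit_cube" "r \<le> \<bar>T y z u0 - g z u0\<bar>" using far[OF y] by auto
    have "ennreal r \<le> ennreal \<bar>T y z u0 - mean_density L w s LH (thinned_law g) z u0\<bar>"
      unfolding dens[OF z(1)] using z(2) by (rule ennreal_leI)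
    also have "\<dots> \<le> sup_dist L (T y) (mean_density L w s LH (thinned_law g))"
      by (rule sup_dist_ge[OF z(1)]) (use u0_interior interior_subset in blast)
    finally show "ennreal r \<le> sup_dist L (T y) (mean_density L w s LH (thinned_law g))" .
  qed
  then have "outer_measure_of ?S G \<le> exceedance_prob L w s LH n r T (thinned_law g)"
    unfolding exceedance_prob_def by (rule outer_measure_of_mono)
  moreover have "outer_measure_of ?S G = emeasure N (\<Phi> -` G \<inter> space N)"
    using G sS emeasure_distr[OF \<Phi> G] sample_law_thinned_law[OF adm, of n]
    by (simp add: \<Phi>_def N_def)
  ultimately show ?thesis by simp
qed

text \<open>
  The bumps are centred at \<open>(c j, u0)\<close> with \<open>c j\<close> on the main diagonal of the cube, spaced by \<open>2 * h\<close>
  in every coordinate. Spreading them over one direction gives only about \<open>1 / h\<close> hypotheses instead of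
  the maximal number, but this is still a power of \<open>n\<close>, so only the constant suffers; in return the
  disjointness of the supports is visible from the covariate alone, and carries over to the events with
  empty diagrams. The estimator induces the test that accepts bump \<open>j\<close> when its value at the centre of
  the bump exceeds the midpoint \<open>a\<close> between the null and the peak. A wrong decision in either direction
  costs at least half the height of the bump.
\<close>

lemma finite_sample_lower_bound:
  fixes T :: "(nat \<Rightarrow> (real ^ 'd) \<times> diagram) \<Rightarrow> real ^ 'd \<Rightarrow> real \<times> real \<Rightarrow> real"
  assumes h: "0 < h" "2 * h \<le> R" and M: "0 < M" "2 * real M * h \<le> 1"
    and small: "4 * (1 + variance_const TYPE('d) * h powr (2 * s + real CARD('d) + 2)) ^ n \<le> real M"
    and T: "T \<in> estimators L n"
  shows "\<exists>P \<in> model_class L w s LH Mw.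
    ennreal (1/4) \<le> exceedance_prob L w s LH n (A * h powr s / 2) T P"
proof -
  define c :: "nat \<Rightarrow> real ^ 'd" where "c j = (\<chi> i. (2 * real j + 1) * h)" for j
  let ?base = "\<lambda>z :: real ^ 'd. base"
  let ?Phi = "compose {1..n} (thinned_observation (ball u0 R))
    :: (nat \<Rightarrow> ((real ^ 'd) \<times> (real \<times> real)) \<times> bool) \<Rightarrow> _"
  let ?N = "\<Pi>\<^sub>M i\<in>{1..n}. null_points :: (((real ^ 'd) \<times> (real \<times> real)) \<times> bool) measure"
  let ?O = "\<Pi>\<^sub>M i\<in>{1..n}. observation_space L :: ((real ^ 'd) \<times> diagram) measure"
  define a where "a = A * R powr s + A * h powr s / 2"
  have hR: "0 \<le> h" "h \<le> R" using h by auto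
  have c_cube: "c j \<in> unit_cube" if "j < M" for j
  proof -
    have "(2 * real j + 1) * h \<le> 2 * real M * h" using that h by (intro mult_right_mono) auto
    also have "\<dots> \<le> 1" by (rule M(2))
    finally show ?thesis using h by (simp add: c_def unit_cube_def)
  qed
  have c_sep: "2 * h \<le> norm (c j - c k)" if "j \<noteq> k" for j k
  proof -
    have "1 \<le> \<bar>real j - real k\<bar>" using that by linarith
    then have "2 * h \<le> 2 * h * \<bar>real j - real k\<bar>" using h by simp
    also have "\<dots> = \<bar>2 * h * (real j - real k)\<bar>" using h by (simp add: abs_mult)
    also have "2 * h * (real j - real k) = (c j - c k) $ undefined"
      by (simp add: c_def algebra_simps)
    also have "\<bar>(c j - c k) $ undefined\<bar> \<le> norm (c j - c k)" by (rule component_le_norm_cart)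
    finally show ?thesis .
  qed
  have u0: "u0 \<in> closed_triangle L" using u0_interior interior_subset by blast
  have T_meas: "(\<lambda>y. T y (c j) u0) \<in> borel_measurable ?O" if "j < M" for j
    using T c_cube[OF that] u0 by (simp add: estimators_def)
  have Phi: "?Phi \<in> measurable ?N ?O"
    unfolding compose_def
    by (intro measurable_restrict measurable_compose[OF measurable_component_singleton]
        thinned_observation_measurable')
  define G where "G j = {y \<in> space ?O. a < T y (c j) u0}" for j
  have G: "G j \<in> sets ?O" if "j < M" for j
    unfolding G_def using T_meas[OF that] by measurable
  have base_holder: "?base \<in> holder_class L s LH"
    using hypothesis_holder[of 0 "0 :: real ^ 'd"] by (simp add: holder_class_def hypothesis_zero)
  have adm: "admissible (hypothesis h (c j))" for j by (rule hypothesis_admissible[OF hR])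
  have model: "thinned_law ?base \<in> model_class L w s LH Mw"
    "thinned_law (hypothesis h (c j)) \<in> model_class L w s LH Mw" for j
    by (rule thinned_law_in_model_class(2)[OF base_admissible base_holder],
        rule thinned_law_in_model_class(2)[OF adm hypothesis_holder])
  have dens: "density null_points (\<lambda>x. ennreal (1 + excess h (c j) x))
      = marked_points (ball u0 R) (retention (hypothesis h (c j)))" for j
    by (rule marked_points_hypothesis[OF h, symmetric])
  have "ennreal (1/4) \<le> emeasure ?N (\<Union>j<M. ?Phi -` G j \<inter> space ?N) \<or>
    (\<exists>j<M. ennreal (1/4) \<le> emeasure
       (\<Pi>\<^sub>M i\<in>{1..n}. density null_points (\<lambda>x. ennreal (1 + excess h (c j) x)))
       (space ?N - (?Phi -` G j \<inter> space ?N)))"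
  proof (rule many_hypotheses_testing[where \<rho> = "variance_const TYPE('d) * h powr (2 * s + real CARD('d) + 2)"])
    show "prob_space (null_points :: (((real ^ 'd) \<times> (real \<times> real)) \<times> bool) measure)"
      by (rule prob_space_thinned_points[OF base_admissible])
    show "excess h (c j) \<in> borel_measurable null_points" for j
      using excess_measurable[OF hR, of "c j"] by (simp cong: measurable_cong_sets add: sets_marked_points)
    show "prob_space (density null_points (\<lambda>x. ennreal (1 + excess h (c j) x)))" for j
      unfolding dens by (rule prob_space_thinned_points[OF adm])
    show "excess h (c j) x * excess h (c k) x = 0" if "j \<noteq> k" for j k x
    proof -
      obtain z u b where x: "x = ((z, u), b)" by (metis surj_pair)
      have "norm (c j - c k) \<le> norm (z - c j) + norm (z - c k)"
        using norm_triangle_ineq4[of "z - c k" "z - c j"] by simp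
      then have "\<not> (norm (z - c j) < h \<and> norm (z - c k) < h)"
        using c_sep[OF that] by linarith
      then show ?thesis
        using excess_bound[OF h, of "c j" z u b] excess_bound[OF h, of "c k" z u b] x by auto
    qed
    show "4 * (1 + variance_const TYPE('d) * h powr (2 * s + real CARD('d) + 2)) ^ card {1..n} \<le> real M"
      using small by simp
    show "?Phi -` G j \<inter> space ?N \<in> sets ?N" if "j < M" for j
      by (rule measurable_sets[OF Phi G[OF that]])
  qed (use M excess_le_one[OF h] excess_second_moment[OF h] in auto)
  then show ?thesis
  proof
    assume *: "ennreal (1/4) \<le> emeasure ?N (\<Union>j<M. ?Phi -` G j \<inter> space ?N)"
    have "(\<Union>j<M. ?Phi -` G j \<inter> space ?N) = ?Phi -` (\<Union>j<M. G j) \<inter> space ?N" by auto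
    moreover have "emeasure ?N (?Phi -` (\<Union>j<M. G j) \<inter> space ?N)
        \<le> exceedance_prob L w s LH n (A * h powr s / 2) T (thinned_law ?base)"
    proof (rule exceedance_prob_ge[OF base_admissible base_holder])
      show "(\<Union>j<M. G j) \<in> sets ?O" using G by auto
      fix y assume "y \<in> (\<Union>j<M. G j)"
      then obtain j where j: "j < M" "a < T y (c j) u0" by (auto simp: G_def)
      have "base u0 = A * R powr s" using R by (simp add: base_def)
      then have "A * h powr s / 2 \<le> \<bar>T y (c j) u0 - base u0\<bar>"
        using j(2) unfolding a_def by linarith
      then show "\<exists>z\<in>unit_cube. A * h powr s / 2 \<le> \<bar>T y z u0 - base u0\<bar>"
        using c_cube[OF j(1)] by blast
    qed
    ultimately show ?thesis using * model(1) by (auto intro: order_trans)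
  next
    assume "\<exists>j<M. ennreal (1/4) \<le> emeasure
       (\<Pi>\<^sub>M i\<in>{1..n}. density null_points (\<lambda>x. ennreal (1 + excess h (c j) x)))
       (space ?N - (?Phi -` G j \<inter> space ?N))"
    then obtain j where j: "j < M" and *: "ennreal (1/4) \<le> emeasure
       (\<Pi>\<^sub>M i\<in>{1..n}. marked_points (ball u0 R) (retention (hypothesis h (c j))))
       (space ?N - (?Phi -` G j \<inter> space ?N))"
      unfolding dens by auto
    let ?H = "\<Pi>\<^sub>M i\<in>{1..n}. marked_points (ball u0 R) (retention (hypothesis h (c j)))"
    have sp: "space ?H = space ?N"
      by (intro sets_eq_imp_space_eq sets_PiM_cong) (simp_all add: sets_marked_points)
    have "space ?N - (?Phi -` G j \<inter> space ?N) = ?Phi -` (space ?O - G j) \<inter> space ?H"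
      using measurable_space[OF Phi] unfolding sp by auto
    moreover have "emeasure ?H (?Phi -` (space ?O - G j) \<inter> space ?H)
        \<le> exceedance_prob L w s LH n (A * h powr s / 2) T (thinned_law (hypothesis h (c j)))"
    proof (rule exceedance_prob_ge[OF adm hypothesis_holder])
      show "space ?O - G j \<in> sets ?O" using G[OF j] by auto
      fix y assume "y \<in> space ?O - G j"
      then have "T y (c j) u0 \<le> a" by (auto simp: G_def)
      then have "A * h powr s / 2 \<le> \<bar>T y (c j) u0 - hypothesis h (c j) (c j) u0\<bar>"
        unfolding hypothesis_peak[OF hR(1)] a_def by linarith
      then show "\<exists>z\<in>unit_cube. A * h powr s / 2 \<le> \<bar>T y z u0 - hypothesis h (c j) z u0\<bar>"
        using c_cube[OF j] by blast
    qed
    ultimately show ?thesis using * model(2)[of j] by (auto intro: order_trans)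
  qed
qed

end

text \<open>
  With this bandwidth \<open>(1 + C * h powr \<beta>) ^ n \<le> exp (ln n / (2 * \<beta>)) = n powr (1 / (2 * \<beta>))\<close>, while the
  number \<open>1 / (2 * h)\<close> of bumps is of the order \<open>n powr (1 / \<beta>)\<close> up to a logarithm, which wins.
\<close>

lemma bandwidth_eventually_admissible:
  fixes C \<beta> R :: real
  assumes C: "0 < C" and \<beta>: "0 < \<beta>" and R: "0 < R"
  defines "h \<equiv> \<lambda>n :: nat. (ln (real n) / (2 * \<beta> * C * real n)) powr (1 / \<beta>)"
  shows "\<forall>\<^sub>F n in sequentially. \<exists>M. 0 < h n \<and> 2 * h n \<le> R \<and> 0 < M \<and>
    2 * real M * h n \<le> 1 \<and> 4 * (1 + C * h n powr \<beta>) ^ n \<le> real M"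
proof -
  have "((\<lambda>n :: nat. ln (real n) / (2 * \<beta> * C * real n)) \<longlongrightarrow> 0) sequentially"
    using C \<beta> by real_asymp
  then have "(h \<longlongrightarrow> 0 powr (1 / \<beta>)) sequentially"
    unfolding h_def using \<beta>
    by (intro tendsto_powr') (auto intro!: tendsto_const eventually_sequentiallyI[of 1] divide_nonneg_nonneg mult_nonneg_nonneg less_imp_le[OF C])
  then have h0: "(h \<longlongrightarrow> 0) sequentially" by simp
  have "((\<lambda>n :: nat. ln (real n) / (2 * \<beta> * C * sqrt (real n))) \<longlongrightarrow> 0) sequentially"
    using C \<beta> by real_asymp
  then have "((\<lambda>n :: nat. (ln (real n) / (2 * \<beta> * C * sqrt (real n))) powr (1 / \<beta>)) \<longlongrightarrow> 0 powr (1 / \<beta>)) sequentially"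
    using \<beta> C
    by (intro tendsto_powr') (auto intro!: tendsto_const eventually_sequentiallyI[of 1] divide_nonneg_nonneg mult_nonneg_nonneg less_imp_le[OF C])
  moreover have "\<forall>\<^sub>F n in sequentially. (ln (real n) / (2 * \<beta> * C * sqrt (real n))) powr (1 / \<beta>)
      = h n * real n powr (1 / (2 * \<beta>))"
    using eventually_ge_at_top[of 1]
  proof eventually_elim
    case (elim n)
    have "real n powr (1 / (2 * \<beta>)) = sqrt (real n) powr (1 / \<beta>)"
      using elim by (simp add: powr_half_sqrt[symmetric] powr_powr)
    moreover have "ln (real n) / (2 * \<beta> * C * sqrt (real n))
        = ln (real n) / (2 * \<beta> * C * real n) * sqrt (real n)"
      using elim C \<beta> by (simp add: field_simps)
    ultimately show ?case
      unfolding h_def using elim C \<beta> by (simp add: powr_mult[symmetric])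
  qed
  ultimately have "((\<lambda>n. h n * real n powr (1 / (2 * \<beta>))) \<longlongrightarrow> 0 powr (1 / \<beta>)) sequentially"
    by (rule Lim_transform_eventually)
  then have hn: "((\<lambda>n. h n * real n powr (1 / (2 * \<beta>))) \<longlongrightarrow> 0) sequentially" by simp
  have "((\<lambda>n. 2 * h n + 8 * (h n * real n powr (1 / (2 * \<beta>)))) \<longlongrightarrow> 2 * 0 + 8 * 0) sequentially"
    by (intro tendsto_intros h0 hn)
  then have "\<forall>\<^sub>F n in sequentially. 2 * h n + 8 * (h n * real n powr (1 / (2 * \<beta>))) < 1"
    by (rule order_tendstoD) simp
  moreover have "\<forall>\<^sub>F n in sequentially. h n < R / 2"
    using h0 by (rule order_tendstoD) (use R in simp)
  ultimately show ?thesis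
    using eventually_ge_at_top[of 2]
  proof eventually_elim
    case (elim n)
    have n: "0 < ln (real n)" "0 < real n" using elim(3) by auto
    have hp: "0 < h n" unfolding h_def using n C \<beta> by simp
    have "C * h n powr \<beta> = ln (real n) / (2 * \<beta>) / real n"
      unfolding h_def using n C \<beta> by (simp add: powr_powr)
    then have "(1 + C * h n powr \<beta>) ^ n \<le> exp (ln (real n) / (2 * \<beta>) / real n) ^ n"
      using n \<beta> C by (intro power_mono) (auto simp: add.commute)
    also have "\<dots> = real n powr (1 / (2 * \<beta>))"
      using n by (simp add: exp_of_nat_mult[symmetric] powr_def)
    finally have pw: "(1 + C * h n powr \<beta>) ^ n \<le> real n powr (1 / (2 * \<beta>))" .
    define M where "M = nat \<lfloor>1 / (2 * h n)\<rfloor>"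
    have "0 \<le> 1 / (2 * h n)" using hp by simp
    then have M: "real M \<le> 1 / (2 * h n)" "1 / (2 * h n) < real M + 1"
      unfolding M_def by linarith+
    have "2 * h n * (4 * real n powr (1 / (2 * \<beta>)) + 1) < 1"
      using elim(1) by (simp add: algebra_simps)
    then have "4 * real n powr (1 / (2 * \<beta>)) + 1 < 1 / (2 * h n)"
      using hp by (simp add: pos_less_divide_eq mult.commute)
    then have M4: "4 * real n powr (1 / (2 * \<beta>)) < real M" using M(2) by linarith
    then have "0 < real M" using powr_ge_zero[of "real n" "1 / (2 * \<beta>)"] by linarith
    moreover have "2 * real M * h n \<le> 1" using M(1) hp by (simp add: field_simps)
    ultimately show ?case using hp elim(2) pw M4 by (intro exI[of _ M]) auto
  qed
qed

text \<open>
  Close to the diagonal, but not on it, \<open>w\<close> is at the same time positive and smaller than any prescribed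
  mass bound, because it is Lipschitz and vanishes on the diagonal.
\<close>

lemma near_diagonal_ball:
  fixes w :: "real \<times> real \<Rightarrow> real" and L Mw :: real
  assumes L: "0 < L" and Mw: "0 < Mw"
    and lip: "C-lipschitz_on (closed_triangle L) w"
    and diag: "\<forall>u \<in> diagonal L. w u = 0"
    and pos: "\<forall>u \<in> open_triangle L. 0 < w u"
  obtains u0 :: "real \<times> real" and R w0 :: real where "0 < R" "0 < w0" "ball u0 R \<subseteq> open_triangle L"
    "\<And>u. u \<in> ball u0 R \<Longrightarrow> w0 \<le> w u" "\<And>u. u \<in> ball u0 R \<Longrightarrow> w u \<le> Mw"
proof -
  have C: "0 \<le> C" using lip by (rule lipschitz_on_nonneg)
  \<comment> \<open>Points of the ball have distance at most \<open>2 * e\<close> from \<open>v\<close>, where \<open>w\<close> vanishes, so \<open>w \<le> 2 * C * e \<le> Mw\<close>.\<close>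
  define e where "e = min (L / 3) (Mw / (2 * (C + 1)))"
  have e: "0 < e" "e \<le> L / 3" "e \<le> Mw / (2 * (C + 1))"
    unfolding e_def using L Mw C by (simp, intro min.cobounded1, intro min.cobounded2)
  define v where "v = (L / 2, L / 2)"
  define u0 where "u0 = (L / 2, L / 2 + e)"
  have sub: "cball u0 (e / 4) \<subseteq> open_triangle L"
  proof
    fix u assume u: "u \<in> cball u0 (e / 4)"
    have "dist (fst u) (fst u0) \<le> e / 4" "dist (snd u) (snd u0) \<le> e / 4"
      using dist_fst_le[of u u0] dist_snd_le[of u u0] u
      by (auto simp: dist_commute intro: order_trans)
    then have "\<bar>fst u - L / 2\<bar> \<le> e / 4" "\<bar>snd u - L / 2 - e\<bar> \<le> e / 4"
      by (simp_all add: u0_def dist_real_def algebra_simps)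
    then have "0 \<le> fst u" "fst u < snd u" "snd u \<le> L"
      using e(1,2) L by linarith+
    then show "u \<in> open_triangle L" by (simp add: open_triangle_def case_prod_beta')
  qed
  then have sub': "cball u0 (e / 4) \<subseteq> closed_triangle L" using open_subset_closed_triangle by blast
  have "continuous_on (cball u0 (e / 4)) w"
    using lipschitz_on_continuous_on[OF lip] sub' by (rule continuous_on_subset)
  then obtain m where m: "m \<in> cball u0 (e / 4)" "\<And>u. u \<in> cball u0 (e / 4) \<Longrightarrow> w m \<le> w u"
    using continuous_attains_inf[OF compact_cball, of u0 "e / 4" w] e by auto
  have v: "v \<in> closed_triangle L" "w v = 0"
    using L diag by (auto simp: v_def closed_triangle_def diagonal_def)
  have le: "w u \<le> Mw" if u: "u \<in> cball u0 (e / 4)" for u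
  proof -
    have "dist u v \<le> dist u u0 + dist u0 v" by (rule dist_triangle)
    also have "dist u0 v = e" using e by (simp add: u0_def v_def dist_norm norm_Pair)
    also have "dist u u0 \<le> e" using u e by (simp add: dist_commute)
    finally have "dist u v \<le> 2 * e" by simp
    have "w u - w v \<le> C * dist u v"
      using lipschitz_onD[OF lip, of u v] u sub' v(1) by (auto simp: dist_real_def)
    also have "\<dots> \<le> (C + 1) * (2 * e)" using C \<open>dist u v \<le> 2 * e\<close> by (intro mult_mono) auto
    also have "\<dots> \<le> Mw" using e(3) C by (simp add: field_simps)
    finally show ?thesis using v by simp
  qed
  show thesis
  proof (rule that[of "e / 4" "w m" u0])
    show "0 < w m" using m(1) sub pos by blast
  qed (use e sub m(2) le in \<open>auto simp: subset_iff\<close>)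
qed

theorem theorem2:
  fixes L s LH Mw :: real and w :: "real \<times> real \<Rightarrow> real"
  assumes "L > 0" and "0 < s" and "s \<le> 1" and "LH > 0" and "Mw > 0"
    and "\<forall>u \<in> closed_triangle L. 0 \<le> w u"
    and "bounded (w ` closed_triangle L)"
    and "\<exists>C. C-lipschitz_on (closed_triangle L) w"
    and "\<forall>u \<in> diagonal L. w u = 0"
    and "\<forall>u \<in> open_triangle L. w u > 0"
  shows "\<exists>c > 0. \<exists>c0 > 0. \<forall>\<^sub>F n in sequentially.
    ennreal c0 \<le>
      (INF T \<in> estimators L n.
        SUP P \<in> (model_class L w s LH Mw :: ((real ^ 'd) \<times> diagram) measure set).
          exceedance_prob L w s LH n
            (c * (ln (real n) / real n) powr (s / (2 * s + real CARD('d) + 2))) T P)"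
proof -
  obtain C where lip: "C-lipschitz_on (closed_triangle L) w" using assms(8) by blast
  obtain u0 R w0 where R: "0 < R" and w0: "0 < w0" and sub: "ball u0 R \<subseteq> open_triangle L"
    and w: "\<And>u. u \<in> ball u0 R \<Longrightarrow> w0 \<le> w u" "\<And>u. u \<in> ball u0 R \<Longrightarrow> w u \<le> Mw"
    by (rule near_diagonal_ball[OF assms(1,5) lip assms(9,10)], rule that)
  \<comment> \<open>The summand \<open>1\<close> only keeps the denominator in the choice of \<open>A\<close> positive.\<close>
  define D where "D = 4 * (measure lborel (ball u0 R) * R powr s) + 1"
  have D: "0 < D" unfolding D_def by (intro add_nonneg_pos mult_nonneg_nonneg) auto
  define A where "A = min (LH / 2) (w0 / D)"
  have A: "0 < A" "2 * A \<le> LH" using assms(4) w0 D by (auto simp: A_def)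
  have "4 * (measure lborel (ball u0 R) * (A * R powr s)) \<le> D * A"
    using A(1) by (simp add: D_def algebra_simps)
  also have "\<dots> \<le> D * (w0 / D)" using D by (intro mult_left_mono) (auto simp: A_def)
  also have "\<dots> = w0" using D by simp
  finally have A': "4 * (measure lborel (ball u0 R) * (A * R powr s)) \<le> w0" .
  interpret bump_model L Mw w u0 R w0 s LH A
    using lipschitz_on_continuous_on[OF lip] R sub w w0 assms(2,3) A A' by unfold_locales auto
  let ?\<beta> = "2 * s + real CARD('d) + 2"
  let ?V = "variance_const TYPE('d)"
  have \<beta>: "0 < ?\<beta>" using assms(2) by simp
  \<comment> \<open>The peak of a bump at the bandwidth \<open>h = (\<kappa> * ln n / n) powr (1 / ?\<beta>)\<close> fixes the constant \<open>c\<close>.\<close>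
  define \<kappa> where "\<kappa> = 1 / (2 * ?\<beta> * ?V)"
  have \<kappa>: "0 < \<kappa>" using \<beta> variance_const_pos[where 'd = 'd] by (simp add: \<kappa>_def)
  define c where "c = A * \<kappa> powr (s / ?\<beta>) / 2"
  have c: "0 < c" using A \<kappa> by (simp add: c_def)
  have "\<forall>\<^sub>F n in sequentially. ennreal (1/4) \<le>
      (INF T \<in> estimators L n.
        SUP P \<in> (model_class L w s LH Mw :: ((real ^ 'd) \<times> diagram) measure set).
          exceedance_prob L w s LH n (c * (ln (real n) / real n) powr (s / ?\<beta>)) T P)"
    using bandwidth_eventually_admissible[OF variance_const_pos[where 'd = 'd] \<beta> R]
      eventually_ge_at_top[of 1]
  proof eventually_elim
    case (elim n)
    define h where "h = (ln (real n) / (2 * ?\<beta> * ?V * real n)) powr (1 / ?\<beta>)"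
    obtain M where M: "0 < h" "2 * h \<le> R" "0 < M" "2 * real M * h \<le> 1"
      "4 * (1 + ?V * h powr ?\<beta>) ^ n \<le> real M"
      using elim(1) unfolding h_def by blast
    have "h = (\<kappa> * (ln (real n) / real n)) powr (1 / ?\<beta>)"
      by (simp add: h_def \<kappa>_def)
    then have "h powr s = (\<kappa> * (ln (real n) / real n)) powr (s / ?\<beta>)"
      by (simp add: powr_powr)
    also have "\<dots> = \<kappa> powr (s / ?\<beta>) * (ln (real n) / real n) powr (s / ?\<beta>)"
      by (rule powr_mult)
    finally have "h powr s = \<kappa> powr (s / ?\<beta>) * (ln (real n) / real n) powr (s / ?\<beta>)" .
    then have r: "c * (ln (real n) / real n) powr (s / ?\<beta>) = A * h powr s / 2"
      by (simp add: c_def)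
    show ?case
      unfolding r
    proof (rule INF_greatest)
      fix T :: "(nat \<Rightarrow> (real ^ 'd) \<times> diagram) \<Rightarrow> real ^ 'd \<Rightarrow> real \<times> real \<Rightarrow> real"
      assume "T \<in> estimators L n"
      then obtain P where "P \<in> model_class L w s LH Mw"
        "ennreal (1/4) \<le> exceedance_prob L w s LH n (A * h powr s / 2) T P"
        using finite_sample_lower_bound[OF M] by blast
      then show "ennreal (1/4) \<le> (SUP P \<in> model_class L w s LH Mw.
          exceedance_prob L w s LH n (A * h powr s / 2) T P)"
        by (rule SUP_upper2)
    qed
  qed
  then show ?thesis using c by (intro exI[of _ c] conjI exI[of _ "1/4 :: real"]) auto
qed

end
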